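(* Let $k\ge0$, let $T$ be a semi-classical arithmetic, and let $X$ be a set of sentences of the language of $\mathsf{HA}$ all belonging to $\mathcal{Q}_{k+1}$. The following are pairwise equivalent: (1) $\mathsf{PA}+X$ is $(\Pi_{k+1}\lor\Pi_{k+1})$-conservative over $T+X$; (2) $T+X$ is closed under $\mathrm{DNE\text{-}R}(\Pi_{k+1}\lor\Pi_{k+1})$; (3) $T+X$ is closed under $\mathrm{CD\text{-}R}(\Pi_{k+1})$; (4) $T+X$ is closed under $\mathrm{DMLD\text{-}R}(\Sigma_{k+1})$; (5) $T+X$ is closed under $\mathrm{DML\text{-}R}(\Sigma_{k+1})$ and $T+X\vdash\mathrm{DNE}(\Sigma_k)$.
   Context: $\mathsf{HA}$ is intuitionistic first-order arithmetic with function symbols for all primitive recursive functions and logical constants $\forall,\exists,\to,\land,\lor,\perp$ ($\neg\varphi:\equiv\varphi\to\perp$); $\mathsf{PA}$ is $\mathsf{HA}$ plus excluded middle for all formulas. A semi-classical arithmetic is a theory $T$ in the language of $\mathsf{HA}$ with $\mathsf{HA}\subseteq T\subseteq\mathsf{PA}$; $T+X$ adds the sentences of $X$ as axioms. $T'$ is $\Gamma$-conservative over $T$ if every formula of $\Gamma$ provable in $T'$ is provable in $T$. $\Sigma_0=\Pi_0$ = quantifier-free formulas; $\Sigma_{k+1}$ = formulas $\exists x_1\cdots\exists x_n\varphi$, $\varphi\in\Pi_k$; $\Pi_{k+1}$ = formulas $\forall x_1\cdots\forall x_n\varphi$, $\varphi\in\Sigma_k$. $\Pi_{k+1}\lor\Pi_{k+1}$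 = formulas $\varphi\lor\psi$ with $\varphi,\psi\in\Pi_{k+1}$. $\mathrm{DNE}(\Sigma_k)$ is the scheme $\neg\neg\varphi\to\varphi$ for $\varphi\in\Sigma_k$. Dual of a prenex formula: $\varphi^\perp:\equiv\neg\varphi$ for quantifier-free $\varphi$; $(\forall x\varphi)^\perp:\equiv\exists x\varphi^\perp$; $(\exists x\varphi)^\perp:\equiv\forall x\varphi^\perp$. Rules (formulas may contain free variables): $T$ is closed under $\mathrm{DNE\text{-}R}(\Gamma)$ if $T\vdash\neg\neg\varphi$ implies $T\vdash\varphi$ for $\varphi\in\Gamma$; under $\mathrm{CD\text{-}R}(\Gamma)$ if $T\vdash\forall x(\varphi\lor\psi)$ implies $T\vdash\varphi\lor\forall x\psi$ for $\varphi,\psi\in\Gamma$ with $x$ not free in $\varphi$; under $\mathrm{DML\text{-}R}(\Gamma)$ if $T\vdash\neg(\varphi\land\psi)$ implies $T\vdash\neg\varphi\lor\neg\psi$ for $\varphi,\psi\in\Gamma$; under $\mathrm{DMLD\text{-}R}(\Gamma)$ if $T\vdash\neg(\varphi\land\psi)$ implies $T\vdash\varphi^\perp\lor\psi^\perp$ for $\varphi,\psi\in\Gamma$. Degree: an alternation path is a finite sequence of symbols $+,-$ in which they alternate; $i(s)$ is the first symbol of $s$ if nonempty and $\times$ if empty, $s^\perp$ swaps $+$ and $-$, $l(s)$ is the length. $\mathrm{Alt}(\varphi)=\{\langle\rangle\}$ for quantifier-free $\varphi$; otherwise $\mathrm{Alt}(\varphi_1\land\varphi_2)=\mathrm{Alt}(\varphi_1\lor\varphi_2)=\mathrm{Alt}(\varphi_1)\cup\mathrm{Alt}(\varphi_2)$,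 $\mathrm{Alt}(\varphi_1\to\varphi_2)=\{s^\perp:s\in\mathrm{Alt}(\varphi_1)\}\cup\mathrm{Alt}(\varphi_2)$, $\mathrm{Alt}(\forall x\varphi_1)=\{s\in\mathrm{Alt}(\varphi_1):i(s)=-\}\cup\{-s:s\in\mathrm{Alt}(\varphi_1),i(s)\ne-\}$, $\mathrm{Alt}(\exists x\varphi_1)=\{s\in\mathrm{Alt}(\varphi_1):i(s)=+\}\cup\{+s:s\in\mathrm{Alt}(\varphi_1),i(s)\ne+\}$. $\deg(\varphi)=\max\{l(s):s\in\mathrm{Alt}(\varphi)\}$; $\mathrm{F}_k^+$ = formulas of degree $\le k$. $\mathcal{R}_0=\mathcal{J}_0=\Sigma_0$; $\mathcal{R}_{k+1},\mathcal{J}_{k+1}$ are simultaneously generated by: every formula of $\mathrm{F}_k^+$ is in both; for $R,R'\in\mathcal{R}_{k+1}$, $J,J'\in\mathcal{J}_{k+1}$: $R\land R',R\lor R',\forall xR,J\to R\in\mathcal{R}_{k+1}$ and $J\land J',J\lor J',\exists xJ,R\to J\in\mathcal{J}_{k+1}$. $\mathcal{Q}_0=\Sigma_0$; $\mathcal{Q}_{k+1}$ is generated by prime formulas and closure under $\land,\lor,\forall x,\exists x$, and $J\to Q$ for $J\in\mathcal{J}_{k+1}$, $Q\in\mathcal{Q}_{k+1}$. *)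

theory Defs
  imports Main
begin

section \<open>The language of HA\<close>

text \<open>
  The function symbols of the language are the pairs \<open>(p, n)\<close> of a code \<open>p\<close> and an arity \<open>n\<close>;
  the arity of an occurrence \<open>Fn p ts\<close> is \<open>length ts\<close>, so every term below is well-formed.
  A code denotes a primitive recursive function in every arity: missing arguments are read as
  \<open>0\<close> and surplus ones are ignored, as made explicit in the defining equations in \<open>HA\<close> below.
  Each primitive recursive definition of an \<open>n\<close>-ary function is such a symbol.
  Recursion is on the first argument.
\<close>

datatype prcode = PZero | PSucc | PProj nat | PComp prcode "prcode list" | PRec prcode prcode

datatype tm = Var nat | Fn prcode "tm list"

abbreviation Zero :: tm where "Zero \<equiv> Fn PZero []"
abbreviation Succ :: "tm \<Rightarrow> tm" where "Succ t \<equiv> Fn PSucc [t]"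

text \<open>Variables are de Bruijn indices: \<open>Forall\<close> and \<open>Exists\<close> bind index \<open>0\<close> of their body.\<close>

datatype fm =
    Bot
  | Eq tm tm
  | Conj fm fm
  | Disj fm fm
  | Imp fm fm
  | Forall fm
  | Exists fm

abbreviation Neg :: "fm \<Rightarrow> fm" where "Neg \<phi> \<equiv> Imp \<phi> Bot"

primrec subst_tm :: "(nat \<Rightarrow> tm) \<Rightarrow> tm \<Rightarrow> tm" where
  "subst_tm \<sigma> (Var n) = \<sigma> n"
| "subst_tm \<sigma> (Fn p ts) = Fn p (map (subst_tm \<sigma>) ts)"

definition lift_subst :: "(nat \<Rightarrow> tm) \<Rightarrow> nat \<Rightarrow> tm" where
  "lift_subst \<sigma> = case_nat (Var 0) (\<lambda>n. subst_tm (\<lambda>m. Var (Suc m)) (\<sigma> n))"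

primrec subst_fm :: "(nat \<Rightarrow> tm) \<Rightarrow> fm \<Rightarrow> fm" where
  "subst_fm \<sigma> Bot = Bot"
| "subst_fm \<sigma> (Eq s t) = Eq (subst_tm \<sigma> s) (subst_tm \<sigma> t)"
| "subst_fm \<sigma> (Conj \<phi> \<psi>) = Conj (subst_fm \<sigma> \<phi>) (subst_fm \<sigma> \<psi>)"
| "subst_fm \<sigma> (Disj \<phi> \<psi>) = Disj (subst_fm \<sigma> \<phi>) (subst_fm \<sigma> \<psi>)"
| "subst_fm \<sigma> (Imp \<phi> \<psi>) = Imp (subst_fm \<sigma> \<phi>) (subst_fm \<sigma> \<psi>)"
| "subst_fm \<sigma> (Forall \<phi>) = Forall (subst_fm (lift_subst \<sigma>) \<phi>)"
| "subst_fm \<sigma> (Exists \<phi>) = Exists (subst_fm (lift_subst \<sigma>) \<phi>)"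

text \<open>
  \<open>lift \<phi>\<close> is \<open>\<phi>\<close> placed under one more binder whose variable does not occur free in it;
  \<open>inst \<phi> t\<close> is the body \<open>\<phi>\<close> of a quantifier with the bound variable replaced by \<open>t\<close>.
\<close>

definition lift :: "fm \<Rightarrow> fm" where
  "lift = subst_fm (\<lambda>n. Var (Suc n))"

definition inst :: "fm \<Rightarrow> tm \<Rightarrow> fm" where
  "inst \<phi> t = subst_fm (case_nat t Var) \<phi>"

primrec fv_tm :: "tm \<Rightarrow> nat set" where
  "fv_tm (Var n) = {n}"
| "fv_tm (Fn p ts) = \<Union> (set (map fv_tm ts))"

primrec fv :: "fm \<Rightarrow> nat set" where
  "fv Bot = {}"
| "fv (Eq s t) = fv_tm s \<union> fv_tm t"
| "fv (Conj \<phi> \<psi>) = fv \<phi> \<union> fv \<psi>"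
| "fv (Disj \<phi> \<psi>) = fv \<phi> \<union> fv \<psi>"
| "fv (Imp \<phi> \<psi>) = fv \<phi> \<union> fv \<psi>"
| "fv (Forall \<phi>) = {n. Suc n \<in> fv \<phi>}"
| "fv (Exists \<phi>) = {n. Suc n \<in> fv \<phi>}"

definition sentence :: "fm \<Rightarrow> bool" where
  "sentence \<phi> \<longleftrightarrow> fv \<phi> = {}"


section \<open>Intuitionistic provability\<close>

text \<open>
  Natural deduction for intuitionistic first-order logic with equality, from a set \<open>T\<close> of
  non-logical axioms and a list of open assumptions. The eigenvariable conditions do not concern
  \<open>T\<close>, so an axiom with free variables has the force of its universal closure.
\<close>

inductive deriv :: "fm set \<Rightarrow> fm list \<Rightarrow> fm \<Rightarrow> bool" for T :: "fm set" where
  Ax: "\<phi> \<in> T \<Longrightarrow> deriv T \<Gamma> \<phi>"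
| Hyp: "\<phi> \<in> set \<Gamma> \<Longrightarrow> deriv T \<Gamma> \<phi>"
| BotE: "deriv T \<Gamma> Bot \<Longrightarrow> deriv T \<Gamma> \<phi>"
| ConjI: "deriv T \<Gamma> \<phi> \<Longrightarrow> deriv T \<Gamma> \<psi> \<Longrightarrow> deriv T \<Gamma> (Conj \<phi> \<psi>)"
| ConjE1: "deriv T \<Gamma> (Conj \<phi> \<psi>) \<Longrightarrow> deriv T \<Gamma> \<phi>"
| ConjE2: "deriv T \<Gamma> (Conj \<phi> \<psi>) \<Longrightarrow> deriv T \<Gamma> \<psi>"
| DisjI1: "deriv T \<Gamma> \<phi> \<Longrightarrow> deriv T \<Gamma> (Disj \<phi> \<psi>)"
| DisjI2: "deriv T \<Gamma> \<psi> \<Longrightarrow> deriv T \<Gamma> (Disj \<phi> \<psi>)"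
| DisjE: "deriv T \<Gamma> (Disj \<phi> \<psi>) \<Longrightarrow> deriv T (\<phi> # \<Gamma>) \<chi> \<Longrightarrow> deriv T (\<psi> # \<Gamma>) \<chi> \<Longrightarrow> deriv T \<Gamma> \<chi>"
| ImpI: "deriv T (\<phi> # \<Gamma>) \<psi> \<Longrightarrow> deriv T \<Gamma> (Imp \<phi> \<psi>)"
| ImpE: "deriv T \<Gamma> (Imp \<phi> \<psi>) \<Longrightarrow> deriv T \<Gamma> \<phi> \<Longrightarrow> deriv T \<Gamma> \<psi>"
| ForallI: "deriv T (map lift \<Gamma>) \<phi> \<Longrightarrow> deriv T \<Gamma> (Forall \<phi>)"
| ForallE: "deriv T \<Gamma> (Forall \<phi>) \<Longrightarrow> deriv T \<Gamma> (inst \<phi> t)"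
| ExistsI: "deriv T \<Gamma> (inst \<phi> t) \<Longrightarrow> deriv T \<Gamma> (Exists \<phi>)"
| ExistsE: "deriv T \<Gamma> (Exists \<phi>) \<Longrightarrow> deriv T (\<phi> # map lift \<Gamma>) (lift \<chi>) \<Longrightarrow> deriv T \<Gamma> \<chi>"
| EqRefl: "deriv T \<Gamma> (Eq t t)"
| EqSubst: "deriv T \<Gamma> (Eq s t) \<Longrightarrow> deriv T \<Gamma> (inst \<phi> s) \<Longrightarrow> deriv T \<Gamma> (inst \<phi> t)"

definition proves :: "fm set \<Rightarrow> fm \<Rightarrow> bool" (infix \<open>\<turnstile>\<close> 50) where
  "T \<turnstile> \<phi> \<longleftrightarrow> deriv T [] \<phi>"


section \<open>Arithmetic\<close>

text \<open>In \<open>Induct\<close>, the substitution replaces the bound variable \<open>x\<close> of \<open>\<phi>\<close> by its successor.\<close>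

inductive_set HA :: "fm set" where
  Succ_not_Zero: "Neg (Eq (Succ t) Zero) \<in> HA"
| Succ_inj: "Imp (Eq (Succ s) (Succ t)) (Eq s t) \<in> HA"
| Zero_eq: "Eq (Fn PZero ts) Zero \<in> HA"
| Succ_eq_Nil: "Eq (Fn PSucc []) (Succ Zero) \<in> HA"
| Succ_eq_Cons: "Eq (Fn PSucc (t # ts)) (Succ t) \<in> HA"
| Proj_eq: "Eq (Fn (PProj i) ts) (if i < length ts then ts ! i else Zero) \<in> HA"
| Comp_eq: "Eq (Fn (PComp g fs) ts) (Fn g (map (\<lambda>f. Fn f ts) fs)) \<in> HA"
| Rec_eq_Nil: "Eq (Fn (PRec g h) []) (Fn g []) \<in> HA"
| Rec_eq_Zero: "Eq (Fn (PRec g h) (Zero # ts)) (Fn g ts) \<in> HA"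
| Rec_eq_Succ: "Eq (Fn (PRec g h) (Succ t # ts)) (Fn h (t # Fn (PRec g h) (t # ts) # ts)) \<in> HA"
| Induct: "Imp (inst \<phi> Zero)
            (Imp (Forall (Imp \<phi> (subst_fm (case_nat (Succ (Var 0)) (\<lambda>n. Var (Suc n))) \<phi>)))
              (Forall \<phi>)) \<in> HA"

definition PA :: "fm set" where
  "PA = HA \<union> {Disj \<phi> (Neg \<phi>) | \<phi>. True}"

text \<open>
  A theory is given by a set of axioms; inclusion of theories is inclusion of their sets of
  theorems, and \<open>T + X\<close> is \<open>T \<union> X\<close>.
\<close>

definition semi_classical :: "fm set \<Rightarrow> bool" where
  "semi_classical T \<longleftrightarrow> {\<phi>. HA \<turnstile> \<phi>} \<subseteq> {\<phi>. T \<turnstile> \<phi>} \<and> {\<phi>. T \<turnstile> \<phi>} \<subseteq> {\<phi>. PA \<turnstile> \<phi>}"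

definition conservative :: "fm set \<Rightarrow> fm set \<Rightarrow> fm set \<Rightarrow> bool" where
  "conservative \<Gamma> T' T \<longleftrightarrow> (\<forall>\<phi>\<in>\<Gamma>. T' \<turnstile> \<phi> \<longrightarrow> T \<turnstile> \<phi>)"


section \<open>Classes of formulas\<close>

primrec qfree :: "fm \<Rightarrow> bool" where
  "qfree Bot \<longleftrightarrow> True"
| "qfree (Eq s t) \<longleftrightarrow> True"
| "qfree (Conj \<phi> \<psi>) \<longleftrightarrow> qfree \<phi> \<and> qfree \<psi>"
| "qfree (Disj \<phi> \<psi>) \<longleftrightarrow> qfree \<phi> \<and> qfree \<psi>"
| "qfree (Imp \<phi> \<psi>) \<longleftrightarrow> qfree \<phi> \<and> qfree \<psi>"
| "qfree (Forall \<phi>) \<longleftrightarrow> False"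
| "qfree (Exists \<phi>) \<longleftrightarrow> False"

text \<open>Quantifier blocks may be empty, so these classes are cumulative.\<close>

fun Sigma_cls :: "nat \<Rightarrow> fm set" and Pi_cls :: "nat \<Rightarrow> fm set" where
  "Sigma_cls 0 = {\<phi>. qfree \<phi>}"
| "Sigma_cls (Suc k) = {(Exists ^^ n) \<phi> | n \<phi>. \<phi> \<in> Pi_cls k}"
| "Pi_cls 0 = {\<phi>. qfree \<phi>}"
| "Pi_cls (Suc k) = {(Forall ^^ n) \<phi> | n \<phi>. \<phi> \<in> Sigma_cls k}"

definition disj_cls :: "fm set \<Rightarrow> fm set \<Rightarrow> fm set" where
  "disj_cls \<Gamma> \<Delta> = {Disj \<phi> \<psi> | \<phi> \<psi>. \<phi> \<in> \<Gamma> \<and> \<psi> \<in> \<Delta>}"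

text \<open>Only meaningful on prenex formulas, where the last clause is the quantifier-free case.\<close>

fun dual :: "fm \<Rightarrow> fm" where
  "dual (Forall \<phi>) = Exists (dual \<phi>)"
| "dual (Exists \<phi>) = Forall (dual \<phi>)"
| "dual \<phi> = Neg \<phi>"

datatype sign = Plus | Minus

primrec flip :: "sign \<Rightarrow> sign" where
  "flip Plus = Minus"
| "flip Minus = Plus"

text \<open>\<open>starts c s\<close> says \<open>i(s) = c\<close>; it is false for the empty path.\<close>

definition starts :: "sign \<Rightarrow> sign list \<Rightarrow> bool" where
  "starts c s \<longleftrightarrow> s \<noteq> [] \<and> hd s = c"

text \<open>The clause for quantifier-free formulas is derived below as \<open>Alt_qfree\<close>.\<close>

primrec Alt :: "fm \<Rightarrow> sign list set" where
  "Alt Bot = {[]}"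
| "Alt (Eq s t) = {[]}"
| "Alt (Conj \<phi> \<psi>) = Alt \<phi> \<union> Alt \<psi>"
| "Alt (Disj \<phi> \<psi>) = Alt \<phi> \<union> Alt \<psi>"
| "Alt (Imp \<phi> \<psi>) = map flip ` Alt \<phi> \<union> Alt \<psi>"
| "Alt (Forall \<phi>) =
    {s \<in> Alt \<phi>. starts Minus s} \<union> {Minus # s | s. s \<in> Alt \<phi> \<and> \<not> starts Minus s}"
| "Alt (Exists \<phi>) =
    {s \<in> Alt \<phi>. starts Plus s} \<union> {Plus # s | s. s \<in> Alt \<phi> \<and> \<not> starts Plus s}"

lemma Alt_qfree: "qfree \<phi> \<Longrightarrow> Alt \<phi> = {[]}"
  by (induction \<phi>) auto

lemma Alt_finite: "finite (Alt \<phi>)"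
  by (induction \<phi>) auto

lemma Alt_nonempty: "Alt \<phi> \<noteq> {}"
  by (induction \<phi>) auto

definition deg :: "fm \<Rightarrow> nat" where
  "deg \<phi> = Max (length ` Alt \<phi>)"

definition F_plus :: "nat \<Rightarrow> fm set" where
  "F_plus k = {\<phi>. deg \<phi> \<le> k}"

inductive R_cls :: "nat \<Rightarrow> fm \<Rightarrow> bool" and J_cls :: "nat \<Rightarrow> fm \<Rightarrow> bool" where
  R_0: "qfree \<phi> \<Longrightarrow> R_cls 0 \<phi>"
| J_0: "qfree \<phi> \<Longrightarrow> J_cls 0 \<phi>"
| R_F: "\<phi> \<in> F_plus k \<Longrightarrow> R_cls (Suc k) \<phi>"
| J_F: "\<phi> \<in> F_plus k \<Longrightarrow> J_cls (Suc k) \<phi>"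
| R_Conj: "R_cls (Suc k) \<phi> \<Longrightarrow> R_cls (Suc k) \<psi> \<Longrightarrow> R_cls (Suc k) (Conj \<phi> \<psi>)"
| R_Disj: "R_cls (Suc k) \<phi> \<Longrightarrow> R_cls (Suc k) \<psi> \<Longrightarrow> R_cls (Suc k) (Disj \<phi> \<psi>)"
| R_Forall: "R_cls (Suc k) \<phi> \<Longrightarrow> R_cls (Suc k) (Forall \<phi>)"
| R_Imp: "J_cls (Suc k) \<phi> \<Longrightarrow> R_cls (Suc k) \<psi> \<Longrightarrow> R_cls (Suc k) (Imp \<phi> \<psi>)"
| J_Conj: "J_cls (Suc k) \<phi> \<Longrightarrow> J_cls (Suc k) \<psi> \<Longrightarrow> J_cls (Suc k) (Conj \<phi> \<psi>)"
| J_Disj: "J_cls (Suc k) \<phi> \<Longrightarrow> J_cls (Suc k) \<psi> \<Longrightarrow> J_cls (Suc k) (Disj \<phi> \<psi>)"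
| J_Exists: "J_cls (Suc k) \<phi> \<Longrightarrow> J_cls (Suc k) (Exists \<phi>)"
| J_Imp: "R_cls (Suc k) \<phi> \<Longrightarrow> J_cls (Suc k) \<psi> \<Longrightarrow> J_cls (Suc k) (Imp \<phi> \<psi>)"

text \<open>The prime formulas are the equations and \<open>Bot\<close>.\<close>

inductive Q_cls :: "nat \<Rightarrow> fm \<Rightarrow> bool" where
  Q_0: "qfree \<phi> \<Longrightarrow> Q_cls 0 \<phi>"
| Q_Bot: "Q_cls (Suc k) Bot"
| Q_Eq: "Q_cls (Suc k) (Eq s t)"
| Q_Conj: "Q_cls (Suc k) \<phi> \<Longrightarrow> Q_cls (Suc k) \<psi> \<Longrightarrow> Q_cls (Suc k) (Conj \<phi> \<psi>)"
| Q_Disj: "Q_cls (Suc k) \<phi> \<Longrightarrow> Q_cls (Suc k) \<psi> \<Longrightarrow> Q_cls (Suc k) (Disj \<phi> \<psi>)"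
| Q_Forall: "Q_cls (Suc k) \<phi> \<Longrightarrow> Q_cls (Suc k) (Forall \<phi>)"
| Q_Exists: "Q_cls (Suc k) \<phi> \<Longrightarrow> Q_cls (Suc k) (Exists \<phi>)"
| Q_Imp: "J_cls (Suc k) \<phi> \<Longrightarrow> Q_cls (Suc k) \<psi> \<Longrightarrow> Q_cls (Suc k) (Imp \<phi> \<psi>)"


section \<open>Schemes and rules\<close>

definition DNE :: "fm set \<Rightarrow> fm set" where
  "DNE \<Gamma> = {Imp (Neg (Neg \<phi>)) \<phi> | \<phi>. \<phi> \<in> \<Gamma>}"

definition closed_DNE_R :: "fm set \<Rightarrow> fm set \<Rightarrow> bool" where
  "closed_DNE_R \<Gamma> T \<longleftrightarrow> (\<forall>\<phi>\<in>\<Gamma>. T \<turnstile> Neg (Neg \<phi>) \<longrightarrow> T \<turnstile> \<phi>)"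

text \<open>The side condition that \<open>x\<close> is not free in \<open>\<phi>\<close> is expressed by \<open>lift \<phi>\<close>.\<close>

definition closed_CD_R :: "fm set \<Rightarrow> fm set \<Rightarrow> bool" where
  "closed_CD_R \<Gamma> T \<longleftrightarrow>
    (\<forall>\<phi>\<in>\<Gamma>. \<forall>\<psi>\<in>\<Gamma>. T \<turnstile> Forall (Disj (lift \<phi>) \<psi>) \<longrightarrow> T \<turnstile> Disj \<phi> (Forall \<psi>))"

definition closed_DML_R :: "fm set \<Rightarrow> fm set \<Rightarrow> bool" where
  "closed_DML_R \<Gamma> T \<longleftrightarrow>
    (\<forall>\<phi>\<in>\<Gamma>. \<forall>\<psi>\<in>\<Gamma>. T \<turnstile> Neg (Conj \<phi> \<psi>) \<longrightarrow> T \<turnstile> Disj (Neg \<phi>) (Neg \<psi>))"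

definition closed_DMLD_R :: "fm set \<Rightarrow> fm set \<Rightarrow> bool" where
  "closed_DMLD_R \<Gamma> T \<longleftrightarrow>
    (\<forall>\<phi>\<in>\<Gamma>. \<forall>\<psi>\<in>\<Gamma>. T \<turnstile> Neg (Conj \<phi> \<psi>) \<longrightarrow> T \<turnstile> Disj (dual \<phi>) (dual \<psi>))"

end

theory Submission
  imports Defs
begin

text \<open>
  Each of the conditions (3), (4), (5) makes all \<open>\<Sigma>\<^sub>k\<close> formulas decidable in \<open>T + X\<close>, by induction along
  the hierarchy; this yields (3) to (4) and the equivalence of (4) and (5), and (1) to (2) to (3) is
  elementary. For (4) to (1), decidability of \<open>\<Sigma>\<^sub>k\<close> gives prenex forms, hence decidability, for all
  formulas of degree at most \<open>k\<close>, on which the negative translation \<open>N\<close> is then the identity up to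
  provable equivalence. It follows that \<open>R \<rightarrow> R\<^sup>N\<close>, \<open>J\<^sup>N \<rightarrow> \<not>\<not>J\<close> and \<open>Q \<rightarrow> Q\<^sup>N\<close> on the three classes,
  so \<open>T + X\<close> proves \<open>X\<^sup>N\<close>. If \<open>PA + X\<close> proves \<open>\<phi> \<or> \<psi>\<close> with both disjuncts in \<open>\<Pi>\<^sub>k\<^sub>+\<^sub>1\<close>, then \<open>T + X\<close>
  proves \<open>\<not>\<not>(\<phi> \<or> \<psi>)\<close>, so it refutes the conjunction of the duals, and DMLD-R gives \<open>\<phi> \<or> \<psi>\<close>.
\<close>

section \<open>Substitution\<close>

lemma subst_tm_subst_tm: "subst_tm \<tau> (subst_tm \<sigma> t) = subst_tm (\<lambda>n. subst_tm \<tau> (\<sigma> n)) t"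
  by (induction t) auto

lemma subst_tm_cong: "(\<And>n. n \<in> fv_tm t \<Longrightarrow> \<sigma> n = \<tau> n) \<Longrightarrow> subst_tm \<sigma> t = subst_tm \<tau> t"
  by (induction t) auto

lemma subst_tm_Var [simp]: "subst_tm Var t = t"
  by (induction t) (auto simp: map_idI)

lemma lift_subst_simps [simp]:
  "lift_subst \<sigma> 0 = Var 0"
  "lift_subst \<sigma> (Suc n) = subst_tm (\<lambda>m. Var (Suc m)) (\<sigma> n)"
  by (simp_all add: lift_subst_def)

lemma lift_subst_Var [simp]: "lift_subst Var = Var"
proof
  show "lift_subst Var n = Var n" for n by (cases n) auto
qed

lemma subst_fm_Var [simp]: "subst_fm Var \<phi> = \<phi>"
  by (induction \<phi>) auto

lemma lift_subst_comp:
  "(\<lambda>n. subst_tm (lift_subst \<tau>) (lift_subst \<sigma> n)) = lift_subst (\<lambda>n. subst_tm \<tau> (\<sigma> n))"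
proof
  show "subst_tm (lift_subst \<tau>) (lift_subst \<sigma> n) = lift_subst (\<lambda>n. subst_tm \<tau> (\<sigma> n)) n" for n
    by (cases n) (auto simp: subst_tm_subst_tm)
qed

lemma subst_fm_subst_fm: "subst_fm \<tau> (subst_fm \<sigma> \<phi>) = subst_fm (\<lambda>n. subst_tm \<tau> (\<sigma> n)) \<phi>"
  by (induction \<phi> arbitrary: \<sigma> \<tau>) (auto simp: subst_tm_subst_tm lift_subst_comp)

lemma subst_fm_cong: "(\<And>n. n \<in> fv \<phi> \<Longrightarrow> \<sigma> n = \<tau> n) \<Longrightarrow> subst_fm \<sigma> \<phi> = subst_fm \<tau> \<phi>"
proof (induction \<phi> arbitrary: \<sigma> \<tau>)
  case (Eq s t)
  then show ?case by (auto intro: subst_tm_cong)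
next
  case (Forall \<phi>)
  have "lift_subst \<sigma> n = lift_subst \<tau> n" if "n \<in> fv \<phi>" for n
    using that Forall.prems by (cases n) auto
  from Forall.IH[OF this] show ?case by simp
next
  case (Exists \<phi>)
  have "lift_subst \<sigma> n = lift_subst \<tau> n" if "n \<in> fv \<phi>" for n
    using that Exists.prems by (cases n) auto
  from Exists.IH[OF this] show ?case by simp
next
  case (Conj \<phi> \<psi>)
  show ?case by (simp; intro conjI Conj.IH Conj.prems) simp_all
next
  case (Disj \<phi> \<psi>)
  show ?case by (simp; intro conjI Disj.IH Disj.prems) simp_all
next
  case (Imp \<phi> \<psi>)
  show ?case by (simp; intro conjI Imp.IH Imp.prems) simp_all
qed simp

lemma finite_fv_tm: "finite (fv_tm t)"
  by (induction t) auto

lemma finite_fv: "finite (fv \<phi>)"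
proof (induction \<phi>)
  case (Forall \<phi>)
  have "{n. Suc n \<in> fv \<phi>} = Suc -` fv \<phi>" by auto
  then show ?case using Forall by (simp add: finite_vimageI)
next
  case (Exists \<phi>)
  have "{n. Suc n \<in> fv \<phi>} = Suc -` fv \<phi>" by auto
  then show ?case using Exists by (simp add: finite_vimageI)
qed (auto simp: finite_fv_tm)

lemma lift_simps [simp]:
  "lift Bot = Bot"
  "lift (Conj \<phi> \<psi>) = Conj (lift \<phi>) (lift \<psi>)"
  "lift (Disj \<phi> \<psi>) = Disj (lift \<phi>) (lift \<psi>)"
  "lift (Imp \<phi> \<psi>) = Imp (lift \<phi>) (lift \<psi>)"
  by (simp_all add: lift_def)

lemma inst_simps [simp]:
  "inst Bot t = Bot"
  "inst (Conj \<phi> \<psi>) t = Conj (inst \<phi> t) (inst \<psi> t)"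
  "inst (Disj \<phi> \<psi>) t = Disj (inst \<phi> t) (inst \<psi> t)"
  "inst (Imp \<phi> \<psi>) t = Imp (inst \<phi> t) (inst \<psi> t)"
  by (simp_all add: inst_def)

lemma inst_lift [simp]: "inst (lift \<phi>) t = \<phi>"
  by (simp add: inst_def lift_def subst_fm_subst_fm)

text \<open>Instantiating a lifted quantifier at the variable just introduced undoes the lifting.
  \<open>lift_ForallD\<close> and \<open>lift_ExistsI\<close> rest on this.\<close>

lemma inst_lift_body: "inst (subst_fm (lift_subst (\<lambda>n. Var (Suc n))) \<phi>) (Var 0) = \<phi>"
proof -
  have "(\<lambda>n. subst_tm (case_nat (Var 0) Var) (lift_subst (\<lambda>n. Var (Suc n)) n)) = Var"
  proof
    show "subst_tm (case_nat (Var 0) Var) (lift_subst (\<lambda>n. Var (Suc n)) n) = Var n" for n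
      by (cases n) auto
  qed
  then show ?thesis by (simp add: inst_def subst_fm_subst_fm)
qed

lemma inst_subst: "inst (subst_fm (lift_subst \<sigma>) \<phi>) t = subst_fm (case_nat t \<sigma>) \<phi>"
proof -
  have "(\<lambda>n. subst_tm (case_nat t Var) (lift_subst \<sigma> n)) = case_nat t \<sigma>"
  proof
    show "subst_tm (case_nat t Var) (lift_subst \<sigma> n) = case_nat t \<sigma> n" for n
      by (cases n) (auto simp: subst_tm_subst_tm)
  qed
  then show ?thesis by (simp add: inst_def subst_fm_subst_fm)
qed


section \<open>Derived rules\<close>

text \<open>
  Contexts behave like the worlds of a Kripke model, ordered by inclusion. The derived rules turn
  intuitionistic reasoning in the object logic into reasoning about all larger contexts.
\<close>

lemma deriv_weaken: "deriv U \<Gamma> \<phi> \<Longrightarrow> set \<Gamma> \<subseteq> set \<Delta> \<Longrightarrow> deriv U \<Delta> \<phi>"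
proof (induction arbitrary: \<Delta> rule: deriv.induct)
  case (DisjE \<Gamma> \<phi> \<psi> \<chi>)
  have "set (\<phi> # \<Gamma>) \<subseteq> set (\<phi> # \<Delta>)" "set (\<psi> # \<Gamma>) \<subseteq> set (\<psi> # \<Delta>)"
    using DisjE.prems by auto
  then show ?case using DisjE by (metis deriv.DisjE)
next
  case (ImpI \<phi> \<Gamma> \<psi>)
  have "set (\<phi> # \<Gamma>) \<subseteq> set (\<phi> # \<Delta>)" using ImpI.prems by auto
  then show ?case using ImpI by (metis deriv.ImpI)
next
  case (ForallI \<Gamma> \<phi>)
  have "set (map lift \<Gamma>) \<subseteq> set (map lift \<Delta>)" using ForallI.prems by auto
  then show ?case using ForallI by (metis deriv.ForallI)
next
  case (ExistsE \<Gamma> \<phi> \<chi>)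
  have "set (\<phi> # map lift \<Gamma>) \<subseteq> set (\<phi> # map lift \<Delta>)" using ExistsE.prems by auto
  then show ?case using ExistsE by (metis deriv.ExistsE)
next
  case (Hyp \<phi> \<Gamma>)
  then show ?case by (meson deriv.Hyp subsetD)
qed (blast intro: deriv.intros)+

lemma proves_deriv: "U \<turnstile> \<phi> \<Longrightarrow> deriv U \<Gamma> \<phi>"
  unfolding proves_def by (rule deriv_weaken) auto

lemma deriv_cut:
  assumes "\<And>\<phi>. \<phi> \<in> U \<Longrightarrow> V \<turnstile> \<phi>"
  shows "deriv U \<Gamma> \<phi> \<Longrightarrow> deriv V \<Gamma> \<phi>"
proof (induction rule: deriv.induct)
  case (Ax \<phi> \<Gamma>)
  then show ?case using assms proves_deriv by blast
qed (blast intro: deriv.intros)+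

lemma proves_cut: "U \<turnstile> \<phi> \<Longrightarrow> (\<And>\<phi>. \<phi> \<in> U \<Longrightarrow> V \<turnstile> \<phi>) \<Longrightarrow> V \<turnstile> \<phi>"
  unfolding proves_def by (rule deriv_cut) (auto simp: proves_def)

lemma proves_mono: "U \<turnstile> \<phi> \<Longrightarrow> U \<subseteq> V \<Longrightarrow> V \<turnstile> \<phi>"
  by (erule proves_cut) (auto simp: proves_def intro: Ax)

lemma ImpI':
  assumes "\<And>\<Delta>. set \<Gamma> \<subseteq> set \<Delta> \<Longrightarrow> deriv U \<Delta> \<phi> \<Longrightarrow> deriv U \<Delta> \<psi>"
  shows "deriv U \<Gamma> (Imp \<phi> \<psi>)"
  by (rule ImpI, rule assms) (auto intro: Hyp)

lemma DisjE':
  assumes "deriv U \<Gamma> (Disj \<phi> \<psi>)"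
    and "\<And>\<Delta>. set \<Gamma> \<subseteq> set \<Delta> \<Longrightarrow> deriv U \<Delta> \<phi> \<Longrightarrow> deriv U \<Delta> \<chi>"
    and "\<And>\<Delta>. set \<Gamma> \<subseteq> set \<Delta> \<Longrightarrow> deriv U \<Delta> \<psi> \<Longrightarrow> deriv U \<Delta> \<chi>"
  shows "deriv U \<Gamma> \<chi>"
  using assms(1) by (rule DisjE; intro assms(2,3); auto intro: Hyp)

lemma deriv_Imp_iff:
  "deriv U \<Gamma> (Imp \<phi> \<psi>) \<longleftrightarrow> (\<forall>\<Delta>. set \<Gamma> \<subseteq> set \<Delta> \<longrightarrow> deriv U \<Delta> \<phi> \<longrightarrow> deriv U \<Delta> \<psi>)"
  using ImpI' ImpE deriv_weaken by metis

lemma deriv_Conj_iff [simp]: "deriv U \<Gamma> (Conj \<phi> \<psi>) \<longleftrightarrow> deriv U \<Gamma> \<phi> \<and> deriv U \<Gamma> \<psi>"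
  using ConjI ConjE1 ConjE2 by blast

text \<open>The eigenvariable condition becomes the lift of a single formula \<open>\<chi>\<close>
  that collects what is used from \<open>\<Gamma>\<close>. The derivation starts from
  \<open>\<chi>\<close> alone, is closed by \<open>ImpI\<close> and then weakened to
  \<open>\<Gamma>\<close>.\<close>

lemma ForallI':
  assumes "deriv U \<Gamma> \<chi>" and "\<And>\<Delta>. deriv U \<Delta> (lift \<chi>) \<Longrightarrow> deriv U \<Delta> \<phi>"
  shows "deriv U \<Gamma> (Forall \<phi>)"
proof -
  have "deriv U (map lift [\<chi>]) \<phi>" by (rule assms(2)) (simp add: Hyp)
  then have "deriv U [\<chi>] (Forall \<phi>)" by (rule ForallI)
  then have "deriv U [] (Imp \<chi> (Forall \<phi>))" by (rule ImpI)
  then show ?thesis using assms(1) ImpE deriv_weaken by (metis empty_subsetI list.set(1))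
qed

text \<open>As in \<open>ForallI'\<close>, one formula \<open>\<rho>\<close> carries the information
  from \<open>\<Gamma>\<close> below the binder.\<close>

lemma ExistsE':
  assumes "deriv U \<Gamma> (Exists \<phi>)" and "deriv U \<Gamma> \<rho>"
    and "\<And>\<Delta>. deriv U \<Delta> \<phi> \<Longrightarrow> deriv U \<Delta> (lift \<rho>) \<Longrightarrow> deriv U \<Delta> (lift \<chi>)"
  shows "deriv U \<Gamma> \<chi>"
proof -
  have "deriv U (\<phi> # map lift [Exists \<phi>, \<rho>]) (lift \<chi>)"
    by (rule assms(3)) (auto intro: Hyp)
  then have "deriv U [Exists \<phi>, \<rho>] \<chi>"
    by (rule ExistsE[rotated]) (simp add: Hyp)
  then have "deriv U [] (Imp \<rho> (Imp (Exists \<phi>) \<chi>))" by (intro ImpI)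
  then have "deriv U \<Gamma> (Imp \<rho> (Imp (Exists \<phi>) \<chi>))" by (rule deriv_weaken) simp
  then show ?thesis using assms(1,2) ImpE by blast
qed

lemma lift_ForallD: "deriv U \<Gamma> (lift (Forall \<phi>)) \<Longrightarrow> deriv U \<Gamma> \<phi>"
  using ForallE[of U \<Gamma> "subst_fm (lift_subst (\<lambda>n. Var (Suc n))) \<phi>" "Var 0"]
  by (simp add: lift_def inst_lift_body)

lemma lift_ExistsI: "deriv U \<Gamma> \<phi> \<Longrightarrow> deriv U \<Gamma> (lift (Exists \<phi>))"
  using ExistsI[of U \<Gamma> "subst_fm (lift_subst (\<lambda>n. Var (Suc n))) \<phi>" "Var 0"]
  by (simp add: lift_def inst_lift_body)

lemma Forall_mono:
  assumes "deriv U \<Gamma> (Forall \<phi>)" and "\<And>\<Delta>. deriv U \<Delta> \<phi> \<Longrightarrow> deriv U \<Delta> \<psi>"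
  shows "deriv U \<Gamma> (Forall \<psi>)"
  using assms(1) by (rule ForallI') (rule assms(2), rule lift_ForallD)

lemma Exists_mono:
  assumes "deriv U \<Gamma> (Exists \<phi>)" and "\<And>\<Delta>. deriv U \<Delta> \<phi> \<Longrightarrow> deriv U \<Delta> \<psi>"
  shows "deriv U \<Gamma> (Exists \<psi>)"
  \<comment> \<open>The existential formula itself fills the place of the side formula
    \<open>\<rho>\<close>.\<close>
  using assms(1,1) by (rule ExistsE') (rule lift_ExistsI, rule assms(2))

lemma Disj_mono:
  assumes "deriv U \<Gamma> (Disj \<phi> \<psi>)"
    and "\<And>\<Delta>. set \<Gamma> \<subseteq> set \<Delta> \<Longrightarrow> deriv U \<Delta> \<phi> \<Longrightarrow> deriv U \<Delta> \<phi>'"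
    and "\<And>\<Delta>. set \<Gamma> \<subseteq> set \<Delta> \<Longrightarrow> deriv U \<Delta> \<psi> \<Longrightarrow> deriv U \<Delta> \<psi>'"
  shows "deriv U \<Gamma> (Disj \<phi>' \<psi>')"
  using assms(1) by (rule DisjE') (auto intro: DisjI1 DisjI2 assms(2,3))

lemma NegE: "deriv U \<Gamma> (Neg \<phi>) \<Longrightarrow> deriv U \<Gamma> \<phi> \<Longrightarrow> deriv U \<Gamma> \<psi>"
  using ImpE BotE by blast

lemma Neg_Neg_I: "deriv U \<Gamma> \<phi> \<Longrightarrow> deriv U \<Gamma> (Neg (Neg \<phi>))"
  by (metis deriv_Imp_iff deriv_weaken order_refl)

text \<open>As long as the goal is doubly negated, a double negation on a premise may be dropped:
  given \<open>Neg \<psi>\<close>, the second assumption refutes \<open>\<phi>\<close>.\<close>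

lemma Neg_Neg_bind:
  assumes "deriv U \<Gamma> (Neg (Neg \<phi>))"
    and "\<And>\<Delta>. set \<Gamma> \<subseteq> set \<Delta> \<Longrightarrow> deriv U \<Delta> \<phi> \<Longrightarrow> deriv U \<Delta> (Neg (Neg \<psi>))"
  shows "deriv U \<Gamma> (Neg (Neg \<psi>))"
proof (rule ImpI')
  fix \<Delta> assume \<Delta>: "set \<Gamma> \<subseteq> set \<Delta>" and n: "deriv U \<Delta> (Neg \<psi>)"
  have "deriv U \<Delta> (Neg \<phi>)"
  proof (rule ImpI')
    fix E assume E: "set \<Delta> \<subseteq> set E" and "deriv U E \<phi>"
    then have "deriv U E (Neg (Neg \<psi>))" using assms(2) \<Delta> by blast
    then show "deriv U E Bot" using ImpE deriv_weaken[OF n E] by blast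
  qed
  then show "deriv U \<Delta> Bot" using ImpE deriv_weaken[OF assms(1) \<Delta>] by blast
qed

text \<open>Index \<open>0\<close> belongs to the innermost quantifier. The induction hypothesis
  instantiates the \<open>n\<close> quantifiers in front of \<open>Forall \<phi>\<close> by the
  shifted \<open>\<sigma>\<close>, and a last \<open>ForallE\<close> supplies
  \<open>\<sigma> 0\<close>.\<close>

lemma proves_generalized_subst:
  "U \<turnstile> (Forall ^^ n) \<phi> \<Longrightarrow> U \<turnstile> subst_fm (\<lambda>i. if i < n then \<sigma> i else Var (i - n)) \<phi>"
proof (induction n arbitrary: \<phi> \<sigma>)
  case (Suc n)
  let ?\<tau> = "\<lambda>i. if i < n then \<sigma> (Suc i) else Var (i - n)"
  have "U \<turnstile> (Forall ^^ n) (Forall \<phi>)" using Suc.prems by (simp add: funpow_swap1)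
  from Suc.IH[OF this, of "\<lambda>i. \<sigma> (Suc i)"]
  have "U \<turnstile> Forall (subst_fm (lift_subst ?\<tau>) \<phi>)" by simp
  then have "U \<turnstile> subst_fm (case_nat (\<sigma> 0) ?\<tau>) \<phi>"
    unfolding proves_def using ForallE inst_subst by metis
  moreover have "case_nat (\<sigma> 0) ?\<tau> = (\<lambda>i. if i < Suc n then \<sigma> i else Var (i - Suc n))"
    by (auto split: nat.split)
  ultimately show ?case by simp
qed simp

text \<open>
  Nothing is assumed about \<open>U\<close>: generalise all free variables of \<open>\<phi>\<close>, then instantiate them.
\<close>

lemma proves_subst:
  assumes "U \<turnstile> \<phi>"
  shows "U \<turnstile> subst_fm \<sigma> \<phi>"
proof -
  obtain n where n: "\<And>i. i \<in> fv \<phi> \<Longrightarrow> i < n"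
    using finite_fv[of \<phi>] finite_nat_set_iff_bounded by auto
  have "U \<turnstile> (Forall ^^ n) \<phi>"
    by (induction n) (use assms in \<open>auto simp: proves_def intro: ForallI\<close>)
  then have "U \<turnstile> subst_fm (\<lambda>i. if i < n then \<sigma> i else Var (i - n)) \<phi>"
    by (rule proves_generalized_subst)
  then show ?thesis
    using subst_fm_cong[of \<phi> "\<lambda>i. if i < n then \<sigma> i else Var (i - n)" \<sigma>] n by simp
qed


section \<open>Provable equivalence and decidability\<close>

text \<open>Quantifying over contexts makes the equivalence usable in the middle of a derivation; by
  \<open>deriv_Imp_iff\<close> it amounts to provability of both implications.\<close>

definition eqv :: "fm set \<Rightarrow> fm \<Rightarrow> fm \<Rightarrow> bool" where
  "eqv U \<phi> \<psi> \<longleftrightarrow> (\<forall>\<Gamma>. deriv U \<Gamma> \<phi> \<longleftrightarrow> deriv U \<Gamma> \<psi>)"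

definition decidable :: "fm set \<Rightarrow> fm \<Rightarrow> bool" where
  "decidable U \<phi> \<longleftrightarrow> U \<turnstile> Disj \<phi> (Neg \<phi>)"

lemma eqvI:
  "(\<And>\<Gamma>. deriv U \<Gamma> \<phi> \<Longrightarrow> deriv U \<Gamma> \<psi>) \<Longrightarrow> (\<And>\<Gamma>. deriv U \<Gamma> \<psi> \<Longrightarrow> deriv U \<Gamma> \<phi>) \<Longrightarrow> eqv U \<phi> \<psi>"
  by (auto simp: eqv_def)

lemma eqv_refl [simp]: "eqv U \<phi> \<phi>"
  and eqv_sym: "eqv U \<phi> \<psi> \<Longrightarrow> eqv U \<psi> \<phi>"
  and eqv_trans [trans]: "eqv U \<phi> \<psi> \<Longrightarrow> eqv U \<psi> \<chi> \<Longrightarrow> eqv U \<phi> \<chi>"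
  by (auto simp: eqv_def)

lemma eqv_Conj: "eqv U \<phi> \<phi>' \<Longrightarrow> eqv U \<psi> \<psi>' \<Longrightarrow> eqv U (Conj \<phi> \<psi>) (Conj \<phi>' \<psi>')"
  by (simp add: eqv_def)

lemma eqv_Disj: "eqv U \<phi> \<phi>' \<Longrightarrow> eqv U \<psi> \<psi>' \<Longrightarrow> eqv U (Disj \<phi> \<psi>) (Disj \<phi>' \<psi>')"
  unfolding eqv_def by (blast intro: Disj_mono)

lemma eqv_Imp: "eqv U \<phi> \<phi>' \<Longrightarrow> eqv U \<psi> \<psi>' \<Longrightarrow> eqv U (Imp \<phi> \<psi>) (Imp \<phi>' \<psi>')"
  by (simp add: eqv_def deriv_Imp_iff)

lemma eqv_Forall: "eqv U \<phi> \<psi> \<Longrightarrow> eqv U (Forall \<phi>) (Forall \<psi>)"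
  unfolding eqv_def by (blast intro: Forall_mono)

lemma eqv_Exists: "eqv U \<phi> \<psi> \<Longrightarrow> eqv U (Exists \<phi>) (Exists \<psi>)"
  unfolding eqv_def by (blast intro: Exists_mono)

lemma eqv_Conj_commute: "eqv U (Conj \<phi> \<psi>) (Conj \<psi> \<phi>)"
  by (auto simp: eqv_def)

lemma eqv_Disj_commute: "eqv U (Disj \<phi> \<psi>) (Disj \<psi> \<phi>)"
  by (rule eqvI; erule DisjE'; blast intro: DisjI1 DisjI2)

lemma Neg_Exists_eqv: "eqv U (Neg (Exists \<phi>)) (Forall (Neg \<phi>))"
proof (rule eqvI)
  fix \<Gamma> assume "deriv U \<Gamma> (Neg (Exists \<phi>))"
  then show "deriv U \<Gamma> (Forall (Neg \<phi>))"
  proof (rule ForallI')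
    fix \<Delta> assume n: "deriv U \<Delta> (lift (Neg (Exists \<phi>)))"
    show "deriv U \<Delta> (Neg \<phi>)"
    proof (rule ImpI')
      fix E assume "set \<Delta> \<subseteq> set E" "deriv U E \<phi>"
      then show "deriv U E Bot" using n lift_ExistsI by (auto simp: deriv_Imp_iff)
    qed
  qed
next
  fix \<Gamma> assume n: "deriv U \<Gamma> (Forall (Neg \<phi>))"
  show "deriv U \<Gamma> (Neg (Exists \<phi>))"
  proof (rule ImpI')
    fix \<Delta> assume \<Delta>: "set \<Gamma> \<subseteq> set \<Delta>" and e: "deriv U \<Delta> (Exists \<phi>)"
    show "deriv U \<Delta> Bot"
      using e deriv_weaken[OF n \<Delta>]
    proof (rule ExistsE')
      fix E assume "deriv U E \<phi>" "deriv U E (lift (Forall (Neg \<phi>)))"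
      then show "deriv U E (lift Bot)" using lift_ForallD ImpE unfolding lift_simps by blast
    qed
  qed
qed

lemma decidable_cases:
  assumes "decidable U \<phi>"
    and "\<And>\<Delta>. set \<Gamma> \<subseteq> set \<Delta> \<Longrightarrow> deriv U \<Delta> \<phi> \<Longrightarrow> deriv U \<Delta> \<chi>"
    and "\<And>\<Delta>. set \<Gamma> \<subseteq> set \<Delta> \<Longrightarrow> deriv U \<Delta> (Neg \<phi>) \<Longrightarrow> deriv U \<Delta> \<chi>"
  shows "deriv U \<Gamma> \<chi>"
  using assms DisjE'[OF proves_deriv] unfolding decidable_def by blast

lemma decidable_stable: "decidable U \<phi> \<Longrightarrow> deriv U \<Gamma> (Neg (Neg \<phi>)) \<Longrightarrow> deriv U \<Gamma> \<phi>"
  by (erule decidable_cases) (auto intro: NegE deriv_weaken)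

lemma decidable_Neg_Neg_eqv: "decidable U \<phi> \<Longrightarrow> eqv U (Neg (Neg \<phi>)) \<phi>"
  by (rule eqvI) (auto intro: decidable_stable Neg_Neg_I)

lemma eqv_decidable: "eqv U \<phi> \<psi> \<Longrightarrow> decidable U \<psi> \<Longrightarrow> decidable U \<phi>"
  using eqv_Disj[OF _ eqv_Imp[OF _ eqv_refl], of U \<phi> \<psi> \<phi> \<psi> Bot]
  by (simp add: decidable_def proves_def eqv_def)

lemma decidable_Bot: "decidable U Bot"
  by (auto simp: decidable_def proves_def intro: DisjI2 ImpI')

lemma decidable_Conj:
  assumes "decidable U \<phi>" "decidable U \<psi>"
  shows "decidable U (Conj \<phi> \<psi>)"
  unfolding decidable_def proves_def
proof (rule decidable_cases[OF assms(1)])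
  fix \<Delta> assume a: "deriv U \<Delta> \<phi>"
  show "deriv U \<Delta> (Disj (Conj \<phi> \<psi>) (Neg (Conj \<phi> \<psi>)))"
  proof (rule decidable_cases[OF assms(2)])
    fix E assume "set \<Delta> \<subseteq> set E" "deriv U E \<psi>"
    then show "deriv U E (Disj (Conj \<phi> \<psi>) (Neg (Conj \<phi> \<psi>)))"
      using deriv_weaken[OF a] by (intro DisjI1) simp
  qed (auto simp: deriv_Imp_iff intro!: DisjI2)
qed (auto simp: deriv_Imp_iff intro!: DisjI2)

lemma decidable_Disj:
  assumes "decidable U \<phi>" "decidable U \<psi>"
  shows "decidable U (Disj \<phi> \<psi>)"
  unfolding decidable_def proves_def
proof (rule decidable_cases[OF assms(1)])
  fix \<Delta> assume a: "deriv U \<Delta> (Neg \<phi>)"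
  show "deriv U \<Delta> (Disj (Disj \<phi> \<psi>) (Neg (Disj \<phi> \<psi>)))"
  proof (rule decidable_cases[OF assms(2)])
    fix E assume E: "set \<Delta> \<subseteq> set E" "deriv U E (Neg \<psi>)"
    have "deriv U E (Neg (Disj \<phi> \<psi>))"
    proof (rule ImpI')
      fix F assume F: "set E \<subseteq> set F" "deriv U F (Disj \<phi> \<psi>)"
      from F(2) show "deriv U F Bot"
      proof (rule DisjE')
        fix G assume "set F \<subseteq> set G" "deriv U G \<phi>"
        then show "deriv U G Bot" using a E(1) F(1) by (auto simp: deriv_Imp_iff)
      next
        fix G assume "set F \<subseteq> set G" "deriv U G \<psi>"
        then show "deriv U G Bot" using E(2) F(1) by (auto simp: deriv_Imp_iff)
      qed
    qed
    then show "deriv U E (Disj (Disj \<phi> \<psi>) (Neg (Disj \<phi> \<psi>)))" by (rule DisjI2)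
  qed (blast intro: DisjI1 DisjI2)
qed (blast intro: DisjI1 DisjI2)

lemma decidable_Imp_eqv:
  assumes "decidable U \<phi>"
  shows "eqv U (Imp \<phi> \<psi>) (Disj (Neg \<phi>) \<psi>)"
proof (rule eqvI)
  fix \<Gamma> assume i: "deriv U \<Gamma> (Imp \<phi> \<psi>)"
  show "deriv U \<Gamma> (Disj (Neg \<phi>) \<psi>)"
  proof (rule decidable_cases[OF assms])
    fix \<Delta> assume "set \<Gamma> \<subseteq> set \<Delta>" "deriv U \<Delta> \<phi>"
    then show "deriv U \<Delta> (Disj (Neg \<phi>) \<psi>)" using i by (auto simp: deriv_Imp_iff intro: DisjI2)
  qed (blast intro: DisjI1)
next
  fix \<Gamma> assume "deriv U \<Gamma> (Disj (Neg \<phi>) \<psi>)"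
  then show "deriv U \<Gamma> (Imp \<phi> \<psi>)"
    by (rule DisjE') (auto simp: deriv_Imp_iff intro: BotE deriv_weaken)
qed

lemma decidable_Neg:
  assumes "decidable U \<phi>"
  shows "decidable U (Neg \<phi>)"
  unfolding decidable_def proves_def
  by (rule decidable_cases[OF assms]) (auto intro: DisjI1 DisjI2 Neg_Neg_I)

lemma decidable_Imp: "decidable U \<phi> \<Longrightarrow> decidable U \<psi> \<Longrightarrow> decidable U (Imp \<phi> \<psi>)"
  using decidable_Imp_eqv decidable_Neg decidable_Disj eqv_decidable by blast


section \<open>Decidability of quantifier-free formulas\<close>

lemma EqSym:
  assumes "deriv U \<Gamma> (Eq s t)"
  shows "deriv U \<Gamma> (Eq t s)"
proof -
  let ?\<phi> = "Eq (Var 0) (subst_tm (\<lambda>n. Var (Suc n)) s)"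
  have i: "inst ?\<phi> r = Eq r s" for r by (simp add: inst_def subst_tm_subst_tm)
  show ?thesis using EqSubst[OF assms, of ?\<phi>] EqRefl by (simp add: i)
qed

lemma EqSucc:
  assumes "deriv U \<Gamma> (Eq s t)"
  shows "deriv U \<Gamma> (Eq (Succ s) (Succ t))"
proof -
  let ?\<phi> = "Eq (Succ (subst_tm (\<lambda>n. Var (Suc n)) s)) (Succ (Var 0))"
  have i: "inst ?\<phi> r = Eq (Succ s) (Succ r)" for r by (simp add: inst_def subst_tm_subst_tm)
  show ?thesis using EqSubst[OF assms, of ?\<phi>] EqRefl by (simp add: i)
qed

locale arithmetic =
  fixes U :: "fm set"
  assumes HA_provable: "\<phi> \<in> HA \<Longrightarrow> U \<turnstile> \<phi>"
begin

lemma HA_deriv: "\<phi> \<in> HA \<Longrightarrow> deriv U \<Gamma> \<phi>"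
  using HA_provable proves_deriv by blast

lemma induction_rule:
  assumes "deriv U \<Gamma> (inst \<phi> Zero)"
    and "deriv U \<Gamma> (Forall (Imp \<phi> (subst_fm (case_nat (Succ (Var 0)) (\<lambda>n. Var (Suc n))) \<phi>)))"
  shows "deriv U \<Gamma> (Forall \<phi>)"
  using assms HA_deriv[OF HA.Induct] ImpE by blast

text \<open>Outer induction on \<open>?x\<close>, with inner inductions on \<open>?y\<close> that
  act as case distinctions. The case of two successors follows from the outer hypothesis at the
  predecessor of the second argument.\<close>

lemma decidable_Eq: "decidable U (Eq s t)"
proof -
  let ?D = "\<lambda>s t. Disj (Eq s t) (Neg (Eq s t))"
  let ?y = "Var 0" and ?x = "Var (Suc 0)"
  have Succ_Zero: "deriv U \<Gamma> (Neg (Eq (Succ r) Zero))" for \<Gamma> r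
    by (rule HA_deriv[OF HA.Succ_not_Zero])
  have Zero_Succ: "deriv U \<Gamma> (?D Zero (Succ r))" for \<Gamma> r
  proof (rule DisjI2, rule ImpI')
    fix \<Delta> assume "deriv U \<Delta> (Eq Zero (Succ r))"
    then show "deriv U \<Delta> Bot" using EqSym ImpE Succ_Zero by blast
  qed
  have Succ_Succ: "deriv U \<Gamma> (?D (Succ r) (Succ r'))" if "deriv U \<Gamma> (?D r r')" for \<Gamma> r r'
    using that
  proof (rule Disj_mono)
    fix \<Delta> assume n: "deriv U \<Delta> (Neg (Eq r r'))"
    show "deriv U \<Delta> (Neg (Eq (Succ r) (Succ r')))"
    proof (rule ImpI')
      fix E assume "set \<Delta> \<subseteq> set E" "deriv U E (Eq (Succ r) (Succ r'))"
      then show "deriv U E Bot"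
        using n HA_deriv[OF HA.Succ_inj] ImpE deriv_weaken by metis
    qed
  qed (rule EqSucc)
  have "deriv U [] (Forall (Forall (?D ?x ?y)))"
  proof (rule induction_rule)
    have "deriv U [] (Forall (?D Zero ?y))"
    proof (rule induction_rule)
      show "deriv U [] (inst (?D Zero ?y) Zero)"
        by (simp add: inst_def EqRefl DisjI1)
      show "deriv U [] (Forall (Imp (?D Zero ?y)
          (subst_fm (case_nat (Succ (Var 0)) (\<lambda>n. Var (Suc n))) (?D Zero ?y))))"
        by (rule ForallI, rule ImpI, simp, rule Zero_Succ)
    qed
    then show "deriv U [] (inst (Forall (?D ?x ?y)) Zero)" by (simp add: inst_def)
  next
    have "deriv U [Forall (?D ?x ?y)] (Forall (?D (Succ ?x) ?y))"
    proof (rule induction_rule)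
      show "deriv U [Forall (?D ?x ?y)] (inst (?D (Succ ?x) ?y) Zero)"
        using Succ_Zero by (simp add: inst_def DisjI2)
      have "deriv U [Forall (?D ?x ?y)] (Forall (?D ?x ?y))" by (simp add: Hyp)
      then show "deriv U [Forall (?D ?x ?y)] (Forall (Imp (?D (Succ ?x) ?y)
          (subst_fm (case_nat (Succ (Var 0)) (\<lambda>n. Var (Suc n))) (?D (Succ ?x) ?y))))"
      proof (rule Forall_mono)
        fix \<Delta> assume "deriv U \<Delta> (?D ?x ?y)"
        then have "deriv U \<Delta> (?D (Succ ?x) (Succ ?y))" by (rule Succ_Succ)
        then show "deriv U \<Delta> (Imp (?D (Succ ?x) ?y)
            (subst_fm (case_nat (Succ (Var 0)) (\<lambda>n. Var (Suc n))) (?D (Succ ?x) ?y)))"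
          by (auto intro!: ImpI' intro: deriv_weaken)
      qed
    qed
    then show "deriv U [] (Forall (Imp (Forall (?D ?x ?y))
        (subst_fm (case_nat (Succ (Var 0)) (\<lambda>n. Var (Suc n))) (Forall (?D ?x ?y)))))"
      by (intro ForallI ImpI) simp
  qed
  then have "deriv U [] (inst (Forall (?D ?x ?y)) s)" by (rule ForallE)
  then have "deriv U [] (Forall (?D (subst_tm (\<lambda>n. Var (Suc n)) s) ?y))"
    by (simp add: inst_def)
  then have "deriv U [] (inst (?D (subst_tm (\<lambda>n. Var (Suc n)) s) ?y) t)" by (rule ForallE)
  then show ?thesis by (simp add: inst_def subst_tm_subst_tm decidable_def proves_def)
qed

lemma qfree_decidable: "qfree \<phi> \<Longrightarrow> decidable U \<phi>"
  by (induction \<phi>)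
    (auto intro: decidable_Bot decidable_Eq decidable_Conj decidable_Disj decidable_Imp)

end

section \<open>Prenex classes and duals\<close>

text \<open>Signs index the two quantifiers here and the two hierarchies in \<open>cls\<close>, so
  that dual arguments are given only once.\<close>

primrec quant :: "sign \<Rightarrow> fm \<Rightarrow> fm" where
  "quant Plus = Exists"
| "quant Minus = Forall"

primrec cls :: "sign \<Rightarrow> nat \<Rightarrow> fm set" where
  "cls Plus = Sigma_cls"
| "cls Minus = Pi_cls"

lemma flip_flip [simp]: "flip (flip c) = c"
  by (cases c) auto

lemma cls_0 [simp]: "cls c 0 = {\<phi>. qfree \<phi>}"
  by (cases c) auto

lemma cls_Suc: "cls c (Suc k) = {(quant c ^^ n) \<phi> | n \<phi>. \<phi> \<in> cls (flip c) k}"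
  by (cases c) auto

lemma cls_flip_Suc: "\<phi> \<in> cls (flip c) k \<Longrightarrow> \<phi> \<in> cls c (Suc k)"
  unfolding cls_Suc by (auto intro!: exI[of _ 0])

lemma cls_quant: "\<phi> \<in> cls c (Suc k) \<Longrightarrow> quant c \<phi> \<in> cls c (Suc k)"
  unfolding cls_Suc by (smt (verit) comp_apply funpow.simps(2) mem_Collect_eq)

lemma cls_Suc_induct [consumes 1, case_names base quant]:
  assumes "\<phi> \<in> cls c (Suc k)"
    and "\<And>\<phi>. \<phi> \<in> cls (flip c) k \<Longrightarrow> P \<phi>"
    and "\<And>\<phi>. \<phi> \<in> cls c (Suc k) \<Longrightarrow> P \<phi> \<Longrightarrow> P (quant c \<phi>)"
  shows "P \<phi>"
proof -
  obtain n \<psi> where \<phi>: "\<phi> = (quant c ^^ n) \<psi>" and \<psi>: "\<psi> \<in> cls (flip c) k"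
    using assms(1) unfolding cls_Suc by auto
  have "(quant c ^^ n) \<psi> \<in> cls c (Suc k) \<and> P ((quant c ^^ n) \<psi>)"
  proof (induction n)
    case 0
    then show ?case using \<psi> assms(2) cls_flip_Suc by simp
  next
    case (Suc n)
    then show ?case using assms(3) cls_quant by simp
  qed
  then show ?thesis using \<phi> by simp
qed

lemma cls_Suc_mono: "\<phi> \<in> cls c k \<Longrightarrow> \<phi> \<in> cls c (Suc k)"
proof (induction k arbitrary: c \<phi>)
  case 0
  then show ?case by (auto intro: cls_flip_Suc)
next
  case (Suc k)
  from Suc.prems show ?case
  proof (induction rule: cls_Suc_induct)
    case (base \<phi>)
    then show ?case using Suc.IH cls_flip_Suc by blast
  next
    case (quant \<phi>)
    then show ?case using cls_quant by blast
  qed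
qed

lemma cls_mono: "j \<le> k \<Longrightarrow> \<phi> \<in> cls c j \<Longrightarrow> \<phi> \<in> cls c k"
  by (induction k rule: dec_induct) (auto intro: cls_Suc_mono)

lemma cls_Suc_any: "\<phi> \<in> cls c k \<Longrightarrow> \<phi> \<in> cls c' (Suc k)"
  by (cases "c' = c") (metis cls_Suc_mono, metis cls_flip_Suc flip.simps sign.exhaust)

lemma cls_induct [consumes 1, case_names qfree Forall Exists]:
  assumes "\<phi> \<in> cls c k"
    and qfree: "\<And>\<phi>. qfree \<phi> \<Longrightarrow> P \<phi>"
    and Forall: "\<And>\<phi>. P \<phi> \<Longrightarrow> P (Forall \<phi>)"
    and Exists: "\<And>\<phi>. P \<phi> \<Longrightarrow> P (Exists \<phi>)"
  shows "P \<phi>"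
  using assms(1)
proof (induction k arbitrary: c \<phi>)
  case 0
  then show ?case using qfree by simp
next
  case (Suc k)
  from Suc.prems show ?case
  proof (induction rule: cls_Suc_induct)
    case (base \<phi>)
    then show ?case by (rule Suc.IH)
  next
    case (quant \<phi>)
    then show ?case using Forall Exists by (cases c) auto
  qed
qed

lemma qfree_subst [simp]: "qfree (subst_fm \<sigma> \<phi>) = qfree \<phi>"
  by (induction \<phi> arbitrary: \<sigma>) auto

lemma subst_quant [simp]: "subst_fm \<sigma> (quant c \<phi>) = quant c (subst_fm (lift_subst \<sigma>) \<phi>)"
  by (cases c) auto

lemma cls_subst: "\<phi> \<in> cls c k \<Longrightarrow> subst_fm \<sigma> \<phi> \<in> cls c k"
proof (induction k arbitrary: c \<phi> \<sigma>)
  case (Suc k)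
  from Suc.prems show ?case
  proof (induction arbitrary: \<sigma> rule: cls_Suc_induct)
    case (base \<phi>)
    then show ?case using Suc.IH cls_flip_Suc by blast
  next
    case (quant \<phi>)
    then show ?case using cls_quant by simp
  qed
qed simp

lemma cls_lift: "\<phi> \<in> cls c k \<Longrightarrow> lift \<phi> \<in> cls c k"
  unfolding lift_def by (rule cls_subst)

lemma dual_quant [simp]: "dual (quant c \<phi>) = quant (flip c) (dual \<phi>)"
  by (cases c) auto

lemma dual_qfree: "qfree \<phi> \<Longrightarrow> dual \<phi> = Neg \<phi>"
  by (cases \<phi>) auto

lemma cls_dual: "\<phi> \<in> cls c k \<Longrightarrow> dual \<phi> \<in> cls (flip c) k"
proof (induction k arbitrary: c \<phi>)
  case 0
  then show ?case by (simp add: dual_qfree)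
next
  case (Suc k)
  from Suc.prems show ?case
  proof (induction rule: cls_Suc_induct)
    case (base \<phi>)
    then show ?case using Suc.IH cls_flip_Suc by blast
  next
    case (quant \<phi>)
    then show ?case using cls_quant by simp
  qed
qed

lemma dual_subst: "dual (subst_fm \<sigma> \<phi>) = subst_fm \<sigma> (dual \<phi>)"
  by (induction \<phi> arbitrary: \<sigma>) auto

lemma dual_lift: "dual (lift \<phi>) = lift (dual \<phi>)"
  unfolding lift_def by (rule dual_subst)

text \<open>This direction is intuitionistic, and it covers arbitrary formulas because
  \<open>dual\<close> is plain negation below the quantifier prefix. The converse is where
  decidability enters.\<close>

lemma dual_imp_Neg: "deriv U \<Gamma> (dual \<phi>) \<Longrightarrow> deriv U \<Gamma> (Neg \<phi>)"
proof (induction \<phi> arbitrary: \<Gamma>)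
  case (Exists \<phi>)
  then have "deriv U \<Gamma> (Forall (Neg \<phi>))" by (auto intro: Forall_mono)
  then show ?case using Neg_Exists_eqv eqv_def by blast
next
  case (Forall \<phi>)
  have e: "deriv U \<Gamma> (Exists (dual \<phi>))" using Forall.prems by simp
  show ?case
  proof (rule ImpI')
    fix \<Delta> assume \<Delta>: "set \<Gamma> \<subseteq> set \<Delta>" and f: "deriv U \<Delta> (Forall \<phi>)"
    from deriv_weaken[OF e \<Delta>] f show "deriv U \<Delta> Bot"
    proof (rule ExistsE')
      fix E assume "deriv U E (dual \<phi>)" "deriv U E (lift (Forall \<phi>))"
      then have "deriv U E (Neg \<phi>)" "deriv U E \<phi>" using Forall.IH lift_ForallD by blast+
      then show "deriv U E (lift Bot)" by (rule NegE)
    qed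
  qed
qed auto

lemma Neg_Conj_dual: "U \<turnstile> Neg (Conj \<phi> (dual \<phi>))"
  unfolding proves_def by (rule ImpI') (auto dest: dual_imp_Neg intro: NegE)

lemma decidable_dual:
  assumes "decidable U \<phi>" and "eqv U (dual \<phi>) (Neg \<phi>)"
  shows "U \<turnstile> Disj \<phi> (dual \<phi>)"
  using assms eqv_Disj[OF eqv_refl] unfolding decidable_def proves_def eqv_def by blast

lemma decidable_of_dual:
  assumes "U \<turnstile> Disj \<phi> (dual \<phi>)"
  shows "decidable U \<phi>"
  using assms unfolding decidable_def proves_def
  by (rule Disj_mono) (auto intro: dual_imp_Neg)

lemma Forall_dual_eqv:
  assumes "eqv U (dual \<phi>) (Neg \<phi>)"
  shows "eqv U (Forall (dual \<phi>)) (Neg (Exists \<phi>))"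
  using eqv_Forall[OF assms] eqv_sym[OF Neg_Exists_eqv] by (rule eqv_trans)

lemma Neg_Exists_dual_eqv:
  assumes "decidable U \<phi>" and "eqv U (dual \<phi>) (Neg \<phi>)"
  shows "eqv U (Neg (Exists (dual \<phi>))) (Forall \<phi>)"
proof -
  have "eqv U (Neg (dual \<phi>)) \<phi>"
    using eqv_Imp[OF assms(2) eqv_refl] decidable_Neg_Neg_eqv[OF assms(1)] by (rule eqv_trans)
  then show ?thesis using Neg_Exists_eqv eqv_Forall eqv_trans by blast
qed

context arithmetic
begin

text \<open>Dualising twice restores the prefix and puts a double negation on the matrix, which is
  quantifier-free and hence decidable.\<close>

lemma dual_dual_eqv: "\<phi> \<in> cls c k \<Longrightarrow> eqv U (dual (dual \<phi>)) \<phi>"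
  by (induction rule: cls_induct)
    (auto simp: dual_qfree intro: decidable_Neg_Neg_eqv qfree_decidable eqv_Forall eqv_Exists)

text \<open>Decidability passes from \<open>Sigma\<close> to \<open>Pi\<close> because
  \<open>Forall \<phi>\<close> is equivalent to the negation of \<open>Exists (dual \<phi>)\<close>,
  a \<open>Sigma\<close> formula of the same level.\<close>

lemma cls_decidable_dual:
  assumes "\<And>\<phi>. \<phi> \<in> Sigma_cls k \<Longrightarrow> decidable U \<phi>" and "\<phi> \<in> cls c k"
  shows "decidable U \<phi> \<and> eqv U (dual \<phi>) (Neg \<phi>)"
  using assms
proof (induction k arbitrary: c \<phi>)
  case 0
  then show ?case by (simp add: dual_qfree qfree_decidable)
next
  case (Suc k)
  have Sigma: "decidable U \<psi>" if "\<psi> \<in> cls Plus (Suc k)" for \<psi>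
    using that Suc.prems(1) by simp
  have IH: "decidable U \<psi> \<and> eqv U (dual \<psi>) (Neg \<psi>)" if "\<psi> \<in> cls c' k" for c' \<psi>
    using Suc.IH[OF _ that] Suc.prems(1) cls_Suc_mono[of _ Plus k] by simp
  from Suc.prems(2) show ?case
  proof (induction rule: cls_Suc_induct)
    case (base \<phi>)
    then show ?case by (rule IH)
  next
    case (quant \<phi>)
    have q: "quant c \<phi> \<in> cls c (Suc k)" using quant.hyps by (rule cls_quant)
    show ?case
    proof (cases c)
      case Plus
      then show ?thesis using Sigma q Forall_dual_eqv quant.IH by simp
    next
      case Minus
      have dec: "decidable U (Exists (dual \<phi>))"
        using Sigma cls_dual[OF q] Minus by simp
      have e: "eqv U (Neg (Exists (dual \<phi>))) (Forall \<phi>)"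
        using quant.IH Neg_Exists_dual_eqv by blast
      have "eqv U (Exists (dual \<phi>)) (Neg (Forall \<phi>))"
        using eqv_sym[OF decidable_Neg_Neg_eqv[OF dec]] eqv_Imp[OF e eqv_refl] by (rule eqv_trans)
      moreover have "decidable U (Forall \<phi>)"
        using eqv_sym[OF e] decidable_Neg[OF dec] by (rule eqv_decidable)
      ultimately show ?thesis using Minus by simp
    qed
  qed
qed

text \<open>This reaches one level above the decidable formulas, since negation turns
  \<open>Exists\<close> into \<open>Forall\<close> intuitionistically.\<close>

lemma Sigma_Suc_dual_eqv_Neg:
  assumes "\<And>\<phi>. \<phi> \<in> Sigma_cls k \<Longrightarrow> decidable U \<phi>" and "\<phi> \<in> Sigma_cls (Suc k)"
  shows "eqv U (dual \<phi>) (Neg \<phi>)"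
proof -
  from assms(2) have "\<phi> \<in> cls Plus (Suc k)" by simp
  then show ?thesis
  proof (induction rule: cls_Suc_induct)
    case (base \<phi>)
    then show ?case using cls_decidable_dual assms(1) by blast
  next
    case (quant \<phi>)
    then show ?case using Forall_dual_eqv by simp
  qed
qed

end

section \<open>Formulas of bounded degree\<close>

lemma Conj_quant_eqv: "eqv U (Conj (quant c \<phi>) \<psi>) (quant c (Conj \<phi> (lift \<psi>)))"
proof (cases c)
  case Plus
  have "eqv U (Conj (Exists \<phi>) \<psi>) (Exists (Conj \<phi> (lift \<psi>)))"
  proof (rule eqvI)
    fix \<Gamma> assume "deriv U \<Gamma> (Conj (Exists \<phi>) \<psi>)"
    then have "deriv U \<Gamma> (Exists \<phi>)" "deriv U \<Gamma> \<psi>" by auto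
    then show "deriv U \<Gamma> (Exists (Conj \<phi> (lift \<psi>)))"
      by (rule ExistsE') (auto intro: lift_ExistsI)
  next
    fix \<Gamma> assume "deriv U \<Gamma> (Exists (Conj \<phi> (lift \<psi>)))"
    from this this show "deriv U \<Gamma> (Conj (Exists \<phi>) \<psi>)"
      by (rule ExistsE') (auto intro: lift_ExistsI)
  qed
  then show ?thesis using Plus by simp
next
  case Minus
  have "eqv U (Conj (Forall \<phi>) \<psi>) (Forall (Conj \<phi> (lift \<psi>)))"
  proof (rule eqvI)
    fix \<Gamma> assume "deriv U \<Gamma> (Conj (Forall \<phi>) \<psi>)"
    then show "deriv U \<Gamma> (Forall (Conj \<phi> (lift \<psi>)))"
      by (rule ForallI') (auto intro: lift_ForallD)
  next
    fix \<Gamma> assume f: "deriv U \<Gamma> (Forall (Conj \<phi> (lift \<psi>)))"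
    then have "deriv U \<Gamma> (Forall \<phi>)" by (rule Forall_mono) simp
    moreover have "deriv U \<Gamma> \<psi>" using ForallE[OF f] by simp
    ultimately show "deriv U \<Gamma> (Conj (Forall \<phi>) \<psi>)" by simp
  qed
  then show ?thesis using Minus by simp
qed

text \<open>The decidability of \<open>\<psi>\<close> serves the constant domain direction, from
  \<open>Forall (Disj \<phi> (lift \<psi>))\<close>: the case distinction on \<open>\<psi>\<close>
  is made outside the quantifier.\<close>

lemma Disj_quant_eqv:
  assumes "decidable U \<psi>"
  shows "eqv U (Disj (quant c \<phi>) \<psi>) (quant c (Disj \<phi> (lift \<psi>)))"
proof (cases c)
  case Plus
  have "eqv U (Disj (Exists \<phi>) \<psi>) (Exists (Disj \<phi> (lift \<psi>)))"
  proof (rule eqvI)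
    fix \<Gamma> assume "deriv U \<Gamma> (Disj (Exists \<phi>) \<psi>)"
    then show "deriv U \<Gamma> (Exists (Disj \<phi> (lift \<psi>)))"
    proof (rule DisjE')
      fix \<Delta> assume "deriv U \<Delta> (Exists \<phi>)"
      then show "deriv U \<Delta> (Exists (Disj \<phi> (lift \<psi>)))" by (rule Exists_mono) (rule DisjI1)
    next
      fix \<Delta> assume "deriv U \<Delta> \<psi>"
      \<comment> \<open>The bound variable does not occur in \<open>lift \<psi>\<close>, so any
        witness works; \<open>Zero\<close> is chosen.\<close>
      then have "deriv U \<Delta> (inst (Disj \<phi> (lift \<psi>)) Zero)" by (simp add: DisjI2)
      then show "deriv U \<Delta> (Exists (Disj \<phi> (lift \<psi>)))" by (rule ExistsI)
    qed
  next
    fix \<Gamma> assume "deriv U \<Gamma> (Exists (Disj \<phi> (lift \<psi>)))"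
    from this this show "deriv U \<Gamma> (Disj (Exists \<phi>) \<psi>)"
      by (rule ExistsE') (unfold lift_simps, erule Disj_mono, auto intro: lift_ExistsI)
  qed
  then show ?thesis using Plus by simp
next
  case Minus
  have "eqv U (Disj (Forall \<phi>) \<psi>) (Forall (Disj \<phi> (lift \<psi>)))"
  proof (rule eqvI)
    fix \<Gamma> assume "deriv U \<Gamma> (Disj (Forall \<phi>) \<psi>)"
    then show "deriv U \<Gamma> (Forall (Disj \<phi> (lift \<psi>)))"
      by (rule ForallI') (unfold lift_simps, erule Disj_mono, auto intro: lift_ForallD)
  next
    fix \<Gamma> assume f: "deriv U \<Gamma> (Forall (Disj \<phi> (lift \<psi>)))"
    show "deriv U \<Gamma> (Disj (Forall \<phi>) \<psi>)"
    proof (rule decidable_cases[OF assms])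
      fix \<Delta> assume \<Delta>: "set \<Gamma> \<subseteq> set \<Delta>" and n: "deriv U \<Delta> (Neg \<psi>)"
      \<comment> \<open>\<open>ForallI'\<close> takes a single formula below the binder, so both
        facts are packed into a conjunction.\<close>
      have "deriv U \<Delta> (Conj (Forall (Disj \<phi> (lift \<psi>))) (Neg \<psi>))"
        using deriv_weaken[OF f \<Delta>] n by simp
      then have "deriv U \<Delta> (Forall \<phi>)"
      proof (rule ForallI')
        fix E assume "deriv U E (lift (Conj (Forall (Disj \<phi> (lift \<psi>))) (Neg \<psi>)))"
        then have d: "deriv U E (Disj \<phi> (lift \<psi>))" and n: "deriv U E (Neg (lift \<psi>))"
          by (auto intro: lift_ForallD)
        from d show "deriv U E \<phi>"
          by (rule DisjE') (auto intro: NegE deriv_weaken[OF n])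
      qed
      then show "deriv U \<Delta> (Disj (Forall \<phi>) \<psi>)" by (rule DisjI1)
    qed (rule DisjI2)
  qed
  then show ?thesis using Minus by simp
qed

section \<open>Alternation paths of quantified formulas\<close>

lemma Alt_quant:
  "Alt (quant c \<phi>) = {s \<in> Alt \<phi>. starts c s} \<union> {c # s | s. s \<in> Alt \<phi> \<and> \<not> starts c s}"
  by (cases c) auto

text \<open>
  \<open>bounded Plus j\<close> and \<open>bounded Minus j\<close> describe the formulas that classically have a prenex form
  in \<open>\<Sigma>\<^sub>j\<close> and \<open>\<Pi>\<^sub>j\<close>: only a path of the maximal length \<open>j\<close> constrains the leading quantifier.
\<close>

definition bounded :: "sign \<Rightarrow> nat \<Rightarrow> fm \<Rightarrow> bool" where
  "bounded c j \<phi> \<longleftrightarrow> (\<forall>s\<in>Alt \<phi>. length s \<le> j \<and> (length s = j \<longrightarrow> s = [] \<or> hd s = c))"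

lemma bounded_Imp: "bounded c j (Imp \<phi> \<psi>) \<longleftrightarrow> bounded (flip c) j \<phi> \<and> bounded c j \<psi>"
proof -
  have flip_eq: "flip d = c \<longleftrightarrow> d = flip c" for d by (cases d; cases c) auto
  have "s = [] \<or> hd (map flip s) = c \<longleftrightarrow> s = [] \<or> hd s = flip c" for s
    by (cases s) (auto simp: flip_eq)
  then show ?thesis by (simp add: bounded_def ball_Un)
qed

lemma Alt_quantI:
  assumes "s \<in> Alt \<phi>"
  shows "s \<in> Alt (quant c \<phi>) \<and> s \<noteq> [] \<and> hd s = c \<or> c # s \<in> Alt (quant c \<phi>)"
  using assms unfolding Alt_quant starts_def by blast

lemma Alt_quantD: "s \<in> Alt (quant c \<phi>) \<Longrightarrow> s \<noteq> [] \<and> hd s = c"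
  unfolding Alt_quant starts_def by auto

lemma bounded_quant:
  assumes "bounded c j (quant c \<phi>)"
  shows "bounded c j \<phi>"
  unfolding bounded_def
proof
  fix s assume "s \<in> Alt \<phi>"
  then consider "s \<in> Alt (quant c \<phi>)" | "c # s \<in> Alt (quant c \<phi>)" using Alt_quantI by blast
  then show "length s \<le> j \<and> (length s = j \<longrightarrow> s = [] \<or> hd s = c)"
  proof cases
    case 1
    then show ?thesis using assms unfolding bounded_def by blast
  next
    case 2
    then have "length (c # s) \<le> j" using assms unfolding bounded_def by blast
    then show ?thesis by simp
  qed
qed

text \<open>Every path of \<open>quant c \<phi>\<close> starts with \<open>c\<close>, while paths of
  length \<open>j\<close> would have to start with \<open>flip c\<close>. So all paths are shorter
  than \<open>j\<close>, and one level is gained.\<close>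

lemma bounded_quant_flip:
  assumes "bounded (flip c) j (quant c \<phi>)"
  obtains i where "j = Suc i" and "bounded c i (quant c \<phi>)"
proof -
  have "flip c \<noteq> c" by (cases c) auto
  then have less: "length s < j" if "s \<in> Alt (quant c \<phi>)" for s
    using that assms Alt_quantD[OF that] unfolding bounded_def by (metis le_neq_implies_less)
  have "j \<noteq> 0" using less Alt_nonempty[of "quant c \<phi>"] by fastforce
  then obtain i where i: "j = Suc i" using not0_implies_Suc by blast
  have "bounded c i (quant c \<phi>)" 
    using less Alt_quantD i unfolding bounded_def by (metis less_Suc_eq_le)
  then show thesis using that i by blast
qed

text \<open>Only paths that do not start with \<open>c\<close> are extended by \<open>c\<close>, and
  by the assumption these are shorter than \<open>Suc j\<close>.\<close>

lemma bounded_quantI: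
  assumes "bounded c (Suc j) \<phi>"
  shows "bounded c (Suc j) (quant c \<phi>)"
proof -
  have "length s \<le> Suc j" if "s \<in> Alt (quant c \<phi>)" for s
  proof -
    from that consider "s \<in> Alt \<phi>" | r where "s = c # r" "r \<in> Alt \<phi>" "\<not> starts c r"
      unfolding Alt_quant by blast
    then show ?thesis
    proof cases
      case 1
      then show ?thesis using assms unfolding bounded_def by blast
    next
      case (2 r)
      then have "length r \<noteq> Suc j" using assms unfolding bounded_def starts_def by auto
      moreover have "length r \<le> Suc j" using 2 assms unfolding bounded_def by blast
      ultimately show ?thesis using 2 by simp
    qed
  qed
  then show ?thesis using Alt_quantD unfolding bounded_def by blast
qed

lemma bounded_Suc: "bounded c j \<phi> \<Longrightarrow> bounded c' (Suc j) \<phi>"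
  unfolding bounded_def by (metis Suc_n_not_le_n le_SucI)

lemma cls_bounded: "\<phi> \<in> cls c j \<Longrightarrow> bounded c j \<phi>"
proof (induction j arbitrary: c \<phi>)
  case 0
  then show ?case by (simp add: bounded_def Alt_qfree)
next
  case (Suc j)
  from Suc.prems show ?case
  proof (induction rule: cls_Suc_induct)
    case (base \<phi>)
    then show ?case using Suc.IH bounded_Suc by blast
  next
    case (quant \<phi>)
    then show ?case using bounded_quantI by blast
  qed
qed

lemma F_plus_iff: "\<phi> \<in> F_plus k \<longleftrightarrow> (\<forall>s\<in>Alt \<phi>. length s \<le> k)"
  unfolding F_plus_def deg_def using Alt_finite Alt_nonempty by simp

text \<open>All paths of a quantified formula start with the sign of its quantifier, so a bound on
  the degree already controls the leading sign.\<close>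

lemma F_plus_quant_bounded: "quant c \<phi> \<in> F_plus k \<Longrightarrow> bounded c k (quant c \<phi>)"
  unfolding F_plus_iff bounded_def using Alt_quantD by blast

lemma F_plus_quant: "quant c \<phi> \<in> F_plus k \<Longrightarrow> \<phi> \<in> F_plus k"
  unfolding F_plus_iff using Alt_quantI by (metis Suc_leD length_Cons)

lemma cls_F_plus: "\<phi> \<in> cls c k \<Longrightarrow> \<phi> \<in> F_plus k"
  using cls_bounded by (auto simp: bounded_def F_plus_iff)

section \<open>Prenex forms and decidability when all \<open>Sigma_cls k\<close> formulas are
  decidable\<close>

locale arithmetic_LEM = arithmetic +
  fixes k :: nat
  assumes Sigma_decidable: "\<phi> \<in> Sigma_cls k \<Longrightarrow> decidable U \<phi>"
begin

lemma cls_decidable: "\<phi> \<in> cls c j \<Longrightarrow> j \<le> k \<Longrightarrow> decidable U \<phi>"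
  using cls_decidable_dual[of k \<phi> c] Sigma_decidable cls_mono by blast

definition prenex :: "sign \<Rightarrow> nat \<Rightarrow> fm \<Rightarrow> bool" where
  "prenex c j \<phi> \<longleftrightarrow> (\<exists>\<psi>\<in>cls c j. eqv U \<phi> \<psi>)"

lemma prenex_decidable: "prenex c j \<phi> \<Longrightarrow> j \<le> k \<Longrightarrow> decidable U \<phi>"
  unfolding prenex_def using cls_decidable eqv_decidable by blast

lemma prenex_eqv: "eqv U \<phi> \<psi> \<Longrightarrow> prenex c j \<psi> \<Longrightarrow> prenex c j \<phi>"
  unfolding prenex_def using eqv_trans by blast

lemma prenex_cls: "\<phi> \<in> cls c j \<Longrightarrow> prenex c j \<phi>"
  unfolding prenex_def using eqv_refl by blast

lemma prenex_Suc: "prenex c j \<phi> \<Longrightarrow> prenex c' (Suc j) \<phi>"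
  unfolding prenex_def using cls_Suc_any by blast

lemma prenex_qfree: "qfree \<phi> \<Longrightarrow> prenex c j \<phi>"
  using prenex_cls[OF cls_mono[of 0 j \<phi> c]] by simp

lemma prenex_quant: "prenex c (Suc j) \<phi> \<Longrightarrow> prenex c (Suc j) (quant c \<phi>)"
  unfolding prenex_def using cls_quant eqv_Exists eqv_Forall
  by (cases c) (metis quant.simps(1), metis quant.simps(2))

text \<open>Conjunction and disjunction are treated together. The leading \<open>c\<close>
  quantifiers of both formulas are pulled out before those of sign \<open>flip c\<close>, so the
  level does not grow. Each pull needs the other formula to be decidable, which
  \<open>j \<le> k\<close> grants.\<close>

lemma prenex_binary:
  fixes f :: "fm \<Rightarrow> fm \<Rightarrow> fm"
  assumes qfree: "\<And>\<phi> \<psi>. qfree \<phi> \<Longrightarrow> qfree \<psi> \<Longrightarrow> qfree (f \<phi> \<psi>)"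
    and cong: "\<And>\<phi> \<phi>' \<psi> \<psi>'. eqv U \<phi> \<phi>' \<Longrightarrow> eqv U \<psi> \<psi>' \<Longrightarrow> eqv U (f \<phi> \<psi>) (f \<phi>' \<psi>')"
    and commute: "\<And>\<phi> \<psi>. eqv U (f \<phi> \<psi>) (f \<psi> \<phi>)"
    and pull: "\<And>c \<phi> \<psi>. decidable U \<psi> \<Longrightarrow> eqv U (f (quant c \<phi>) \<psi>) (quant c (f \<phi> (lift \<psi>)))"
    and "j \<le> k" "prenex c j \<phi>" "prenex c j \<psi>"
  shows "prenex c j (f \<phi> \<psi>)"
proof -
  have "prenex c j (f \<phi> \<psi>)" if "j \<le> k" "\<phi> \<in> cls c j" "\<psi> \<in> cls c j" for \<phi> \<psi>
    using that
  proof (induction j arbitrary: c \<phi> \<psi>)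
    case 0
    then show ?case using qfree prenex_qfree by simp
  next
    case (Suc j)
    \<comment> \<open>Here the leading block of the left formula is used up; commuting the arguments
      lets the quantifiers of the right one be pulled.\<close>
    have flip: "prenex c (Suc j) (f \<phi> \<psi>)" if "\<phi> \<in> cls (flip c) j" "\<psi> \<in> cls c (Suc j)" for \<phi> \<psi>
      using that(2,1)
    proof (induction arbitrary: \<phi> rule: cls_Suc_induct)
      case (base \<psi>)
      then show ?case using Suc.IH Suc.prems(1) prenex_Suc by (meson Suc_leD)
    next
      case (quant \<psi>)
      have "decidable U \<phi>" using quant.prems cls_decidable Suc.prems(1) Suc_leD by blast
      then have "eqv U (f \<phi> (quant c \<psi>)) (quant c (f \<psi> (lift \<phi>)))"
        using commute pull eqv_trans by blast
      moreover have "prenex c (Suc j) (f \<psi> (lift \<phi>))"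
        using commute quant.IH[OF cls_lift[OF quant.prems]] by (rule prenex_eqv)
      ultimately show ?case using prenex_quant prenex_eqv by blast
    qed
    from Suc.prems(2,3) show ?case
    proof (induction arbitrary: \<psi> rule: cls_Suc_induct)
      case (base \<phi>)
      then show ?case using flip by blast
    next
      case (quant \<phi>)
      have "decidable U \<psi>" using quant.prems cls_decidable Suc.prems(1) by blast
      then have "eqv U (f (quant c \<phi>) \<psi>) (quant c (f \<phi> (lift \<psi>)))" by (rule pull)
      moreover have "prenex c (Suc j) (f \<phi> (lift \<psi>))"
        using quant.IH[OF cls_lift[OF quant.prems]] .
      ultimately show ?case using prenex_quant prenex_eqv by blast
    qed
  qed
  then show ?thesis using assms(5-7) cong prenex_eqv unfolding prenex_def by meson
qed

lemma prenex_Conj: "j \<le> k \<Longrightarrow> prenex c j \<phi> \<Longrightarrow> prenex c j \<psi> \<Longrightarrow> prenex c j (Conj \<phi> \<psi>)"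
  by (rule prenex_binary) (auto intro: eqv_Conj eqv_Conj_commute Conj_quant_eqv)

lemma prenex_Disj: "j \<le> k \<Longrightarrow> prenex c j \<phi> \<Longrightarrow> prenex c j \<psi> \<Longrightarrow> prenex c j (Disj \<phi> \<psi>)"
  by (rule prenex_binary) (auto intro: eqv_Disj eqv_Disj_commute Disj_quant_eqv)

lemma prenex_Neg:
  assumes "j \<le> k" and "prenex c j \<phi>"
  shows "prenex (flip c) j (Neg \<phi>)"
proof -
  obtain \<psi> where \<psi>: "\<psi> \<in> cls c j" "eqv U \<phi> \<psi>" using assms(2) unfolding prenex_def by blast
  have "eqv U (dual \<psi>) (Neg \<psi>)"
    using cls_decidable_dual[of k \<psi> c] Sigma_decidable cls_mono[OF assms(1) \<psi>(1)] by blast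
  then have "eqv U (Neg \<phi>) (dual \<psi>)" using eqv_Imp[OF \<psi>(2) eqv_refl] eqv_sym eqv_trans by blast
  then show ?thesis using cls_dual[OF \<psi>(1)] unfolding prenex_def by blast
qed

lemma prenex_Imp:
  assumes "j \<le> k" and "prenex (flip c) j \<phi>" and "prenex c j \<psi>"
  shows "prenex c j (Imp \<phi> \<psi>)"
proof -
  have "prenex c j (Neg \<phi>)" using prenex_Neg[OF assms(1,2)] by simp
  then have "prenex c j (Disj (Neg \<phi>) \<psi>)" using prenex_Disj assms by blast
  then show ?thesis using decidable_Imp_eqv prenex_decidable assms(1,2) prenex_eqv by blast
qed

text \<open>At its own sign the quantifier is put in front of a prenex form of the body. At the
  opposite sign the bound drops by one level, where the first case applies.\<close>

lemma bounded_prenex_quant: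
  assumes IH: "\<And>c j. j \<le> k \<Longrightarrow> bounded c j \<phi> \<Longrightarrow> prenex c j \<phi>"
    and "j \<le> k" and "bounded c' j (quant c \<phi>)"
  shows "prenex c' j (quant c \<phi>)"
proof -
  have same: "prenex c i (quant c \<phi>)" if "i \<le> k" "bounded c i (quant c \<phi>)" for i
  proof (cases i)
    case 0
    have "\<exists>s\<in>Alt (quant c \<phi>). s \<noteq> []"
      using Alt_nonempty[of "quant c \<phi>"] unfolding Alt_quant starts_def by auto
    then show ?thesis using that(2) 0 unfolding bounded_def by auto
  next
    case (Suc n)
    then show ?thesis using that IH bounded_quant prenex_quant by blast
  qed
  show ?thesis
  proof (cases "c' = c")
    case True
    then show ?thesis using assms(2,3) same by blast
  next
    case False
    then have "c' = flip c" by (cases c; cases c') auto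
    then obtain i where "j = Suc i" "bounded c i (quant c \<phi>)"
      using assms(3) bounded_quant_flip by blast
    then show ?thesis using same[of i] assms(2) prenex_Suc by simp
  qed
qed

lemma bounded_prenex: "j \<le> k \<Longrightarrow> bounded c j \<phi> \<Longrightarrow> prenex c j \<phi>"
proof (induction \<phi> arbitrary: c j)
  case (Conj \<phi> \<psi>)
  then show ?case by (auto simp: bounded_def ball_Un intro!: prenex_Conj)
next
  case (Disj \<phi> \<psi>)
  then show ?case by (auto simp: bounded_def ball_Un intro!: prenex_Disj)
next
  case (Imp \<phi> \<psi>)
  then show ?case using prenex_Imp bounded_Imp by blast
next
  case (Forall \<phi>)
  then show ?case using bounded_prenex_quant[of \<phi> j c Minus] by simp
next
  case (Exists \<phi>)
  then show ?case using bounded_prenex_quant[of \<phi> j c Plus] by simp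
qed (auto intro: prenex_qfree)

text \<open>A disjunction of a \<open>Sigma_cls k\<close> and a \<open>Pi_cls k\<close> formula may
  be \<open>bounded\<close> at level \<open>k\<close> for neither sign. Decidability is therefore
  built up through the connectives, and only the outermost quantified subformulas are brought to
  prenex form.\<close>

lemma F_plus_decidable: "\<phi> \<in> F_plus k \<Longrightarrow> decidable U \<phi>"
proof (induction \<phi>)
  case (Forall \<phi>)
  then have "bounded Minus k (Forall \<phi>)" using F_plus_quant_bounded[of Minus] by simp
  then show ?case using bounded_prenex prenex_decidable by blast
next
  case (Exists \<phi>)
  then have "bounded Plus k (Exists \<phi>)" using F_plus_quant_bounded[of Plus] by simp
  then show ?case using bounded_prenex prenex_decidable by blast
qed (auto simp: F_plus_iff ball_Un
    intro: decidable_Bot decidable_Eq decidable_Conj decidable_Disj decidable_Imp)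

end

section \<open>The negative translation\<close>

text \<open>The Goedel-Gentzen translation. Equations are left unchanged because they are decidable
  in arithmetic.\<close>

primrec neg_trans :: "fm \<Rightarrow> fm" where
  "neg_trans Bot = Bot"
| "neg_trans (Eq s t) = Eq s t"
| "neg_trans (Conj \<phi> \<psi>) = Conj (neg_trans \<phi>) (neg_trans \<psi>)"
| "neg_trans (Disj \<phi> \<psi>) = Neg (Neg (Disj (neg_trans \<phi>) (neg_trans \<psi>)))"
| "neg_trans (Imp \<phi> \<psi>) = Imp (neg_trans \<phi>) (neg_trans \<psi>)"
| "neg_trans (Forall \<phi>) = Forall (neg_trans \<phi>)"
| "neg_trans (Exists \<phi>) = Neg (Neg (Exists (neg_trans \<phi>)))"

lemma neg_trans_subst: "neg_trans (subst_fm \<sigma> \<phi>) = subst_fm \<sigma> (neg_trans \<phi>)"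
  by (induction \<phi> arbitrary: \<sigma>) auto

lemma neg_trans_lift: "neg_trans (lift \<phi>) = lift (neg_trans \<phi>)"
  unfolding lift_def by (rule neg_trans_subst)

lemma neg_trans_inst: "neg_trans (inst \<phi> t) = inst (neg_trans \<phi>) t"
  unfolding inst_def by (rule neg_trans_subst)

text \<open>The translation commutes with substitution, so an instance of induction becomes another
  instance; the other axioms contain neither disjunction nor a quantifier and are fixed.\<close>

lemma HA_neg_trans: "\<phi> \<in> HA \<Longrightarrow> neg_trans \<phi> \<in> HA"
proof (induction rule: HA.induct)
  case (Proj_eq i ts)
  show ?case unfolding neg_trans.simps by (rule HA.Proj_eq)
qed (auto simp: neg_trans_inst neg_trans_subst intro: HA.intros)

lemma Neg_Neg_LEM: "deriv U \<Gamma> (Neg (Neg (Disj \<phi> (Neg \<phi>))))"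
proof (rule ImpI')
  fix \<Delta> assume n: "deriv U \<Delta> (Neg (Disj \<phi> (Neg \<phi>)))"
  have "deriv U \<Delta> (Neg \<phi>)"
  proof (rule ImpI')
    fix E assume "set \<Delta> \<subseteq> set E" "deriv U E \<phi>"
    then show "deriv U E Bot" using n DisjI1 unfolding deriv_Imp_iff by blast
  qed
  then show "deriv U \<Delta> Bot" using n DisjI2 ImpE by blast
qed

text \<open>\<open>Neg (Imp \<phi> \<psi>)\<close> yields \<open>Neg \<psi>\<close>; then
  \<open>\<phi>\<close> is contradictory and implies \<open>\<psi>\<close>. This is used for the
  implications in \<open>J_cls\<close>.\<close>

lemma Imp_Neg_Neg:
  assumes "deriv U \<Gamma> (Imp \<phi> (Neg (Neg \<psi>)))"
  shows "deriv U \<Gamma> (Neg (Neg (Imp \<phi> \<psi>)))"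
proof (rule ImpI')
  fix \<Delta> assume \<Delta>: "set \<Gamma> \<subseteq> set \<Delta>" and n: "deriv U \<Delta> (Neg (Imp \<phi> \<psi>))"
  have n\<psi>: "deriv U \<Delta> (Neg \<psi>)"
  proof (rule ImpI')
    fix E assume E: "set \<Delta> \<subseteq> set E" and "deriv U E \<psi>"
    then have "deriv U E (Imp \<phi> \<psi>)" using deriv_weaken ImpI' by blast
    then show "deriv U E Bot" using deriv_weaken[OF n E] ImpE by blast
  qed
  have "deriv U \<Delta> (Imp \<phi> \<psi>)"
  proof (rule ImpI')
    fix E assume E: "set \<Delta> \<subseteq> set E" and "deriv U E \<phi>"
    then have "deriv U E (Neg (Neg \<psi>))" using assms \<Delta> unfolding deriv_Imp_iff by blast
    then show "deriv U E \<psi>" using deriv_weaken[OF n\<psi> E] by (rule NegE)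
  qed
  then show "deriv U \<Delta> Bot" using n ImpE by blast
qed

context arithmetic
begin

lemma neg_trans_stable: "deriv U \<Gamma> (Neg (Neg (neg_trans \<phi>))) \<Longrightarrow> deriv U \<Gamma> (neg_trans \<phi>)"
proof (induction \<phi> arbitrary: \<Gamma>)
  case Bot
  then show ?case using decidable_stable[OF decidable_Bot] by simp
next
  case (Eq s t)
  then show ?case using decidable_stable[OF decidable_Eq] by simp
next
  case (Conj \<phi> \<psi>)
  have "deriv U \<Gamma> (Neg (Neg (neg_trans \<phi>)))" "deriv U \<Gamma> (Neg (Neg (neg_trans \<psi>)))"
    using Conj.prems by (auto elim!: Neg_Neg_bind intro: Neg_Neg_I)
  then show ?case using Conj.IH by simp
next
  case (Disj \<phi> \<psi>)
  from Disj.prems show ?case unfolding neg_trans.simps by (rule Neg_Neg_bind)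
next
  case (Imp \<phi> \<psi>)
  show ?case unfolding neg_trans.simps
  proof (rule ImpI', rule Imp.IH)
    fix \<Delta> assume \<Delta>: "set \<Gamma> \<subseteq> set \<Delta>" and p: "deriv U \<Delta> (neg_trans \<phi>)"
    from deriv_weaken[OF Imp.prems \<Delta>] show "deriv U \<Delta> (Neg (Neg (neg_trans \<psi>)))"
    proof (rule Neg_Neg_bind)
      fix E assume "set \<Delta> \<subseteq> set E" "deriv U E (neg_trans (Imp \<phi> \<psi>))"
      then show "deriv U E (Neg (Neg (neg_trans \<psi>)))"
        using p deriv_weaken ImpE Neg_Neg_I unfolding neg_trans.simps by blast
    qed
  qed
next
  case (Forall \<phi>)
  from Forall.prems have "deriv U \<Gamma> (Forall (neg_trans \<phi>))"
  proof (rule ForallI')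
    fix \<Delta> assume "deriv U \<Delta> (lift (Neg (Neg (neg_trans (Forall \<phi>)))))"
    then have "deriv U \<Delta> (Neg (Neg (lift (Forall (neg_trans \<phi>)))))" by simp
    then have "deriv U \<Delta> (Neg (Neg (neg_trans \<phi>)))"
      by (rule Neg_Neg_bind) (rule Neg_Neg_I, rule lift_ForallD)
    then show "deriv U \<Delta> (neg_trans \<phi>)" by (rule Forall.IH)
  qed
  then show ?case by simp
next
  case (Exists \<phi>)
  from Exists.prems show ?case unfolding neg_trans.simps by (rule Neg_Neg_bind)
qed

text \<open>Excluded middle translates to \<open>Neg_Neg_LEM\<close>. The eliminations of
  disjunction and existence are carried out under a double negation, which
  \<open>neg_trans_stable\<close> then removes.\<close>

lemma neg_trans_sound:
  assumes "\<And>\<phi>. \<phi> \<in> X \<Longrightarrow> U \<turnstile> neg_trans \<phi>"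
  shows "deriv (PA \<union> X) \<Gamma> \<phi> \<Longrightarrow> deriv U (map neg_trans \<Gamma>) (neg_trans \<phi>)"
proof (induction rule: deriv.induct)
  case (Ax \<phi> \<Gamma>)
  then consider "\<phi> \<in> HA" | \<psi> where "\<phi> = Disj \<psi> (Neg \<psi>)" | "\<phi> \<in> X"
    unfolding PA_def by blast
  then show ?case
  proof cases
    case 1
    then show ?thesis using HA_neg_trans HA_deriv by blast
  next
    case 2
    then show ?thesis using Neg_Neg_LEM by simp
  next
    case 3
    then show ?thesis using assms proves_deriv by blast
  qed
next
  case (Hyp \<phi> \<Gamma>)
  then show ?case by (simp add: deriv.Hyp)
next
  case (BotE \<Gamma> \<phi>)
  then show ?case by (simp add: deriv.BotE)
next
  case (DisjI1 \<Gamma> \<phi> \<psi>)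
  then show ?case by (simp add: Neg_Neg_I deriv.DisjI1)
next
  case (DisjI2 \<Gamma> \<psi> \<phi>)
  then show ?case by (simp add: Neg_Neg_I deriv.DisjI2)
next
  case (DisjE \<Gamma> \<phi> \<psi> \<chi>)
  let ?\<Gamma> = "map neg_trans \<Gamma>"
  have "deriv U ?\<Gamma> (Imp (neg_trans \<phi>) (neg_trans \<chi>))" "deriv U ?\<Gamma> (Imp (neg_trans \<psi>) (neg_trans \<chi>))"
    using DisjE.IH(2,3) by (auto intro: deriv.ImpI)
  then have cases: "deriv U \<Delta> (neg_trans \<chi>)"
    if "set ?\<Gamma> \<subseteq> set \<Delta>" "deriv U \<Delta> (neg_trans \<phi>) \<or> deriv U \<Delta> (neg_trans \<psi>)" for \<Delta>
    using that unfolding deriv_Imp_iff by blast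
  have "deriv U ?\<Gamma> (Neg (Neg (Disj (neg_trans \<phi>) (neg_trans \<psi>))))" using DisjE.IH(1) by simp
  then have "deriv U ?\<Gamma> (Neg (Neg (neg_trans \<chi>)))"
  proof (rule Neg_Neg_bind)
    fix \<Delta> assume \<Delta>: "set ?\<Gamma> \<subseteq> set \<Delta>" and d: "deriv U \<Delta> (Disj (neg_trans \<phi>) (neg_trans \<psi>))"
    from d have "deriv U \<Delta> (neg_trans \<chi>)"
      by (rule DisjE') (use \<Delta> cases in blast)+
    then show "deriv U \<Delta> (Neg (Neg (neg_trans \<chi>)))" by (rule Neg_Neg_I)
  qed
  then show ?case by (rule neg_trans_stable)
next
  case (ImpI \<phi> \<Gamma> \<psi>)
  then show ?case by (simp add: deriv.ImpI)
next
  case (ImpE \<Gamma> \<phi> \<psi>)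
  then show ?case using deriv.ImpE by simp
next
  case (ForallI \<Gamma> \<phi>)
  then show ?case by (simp add: deriv.ForallI neg_trans_lift comp_def)
next
  case (ForallE \<Gamma> \<phi> t)
  then show ?case by (simp add: deriv.ForallE neg_trans_inst)
next
  case (ExistsI \<Gamma> \<phi> t)
  then show ?case by (metis Neg_Neg_I deriv.ExistsI neg_trans.simps(7) neg_trans_inst)
next
  case (ExistsE \<Gamma> \<phi> \<chi>)
  let ?\<Gamma> = "map neg_trans \<Gamma>"
  have \<chi>: "deriv U (neg_trans \<phi> # map lift ?\<Gamma>) (lift (neg_trans \<chi>))"
    using ExistsE.IH(2) by (simp add: neg_trans_lift comp_def)
  have "deriv U ?\<Gamma> (Neg (Neg (Exists (neg_trans \<phi>))))" using ExistsE.IH(1) by simp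
  then have "deriv U ?\<Gamma> (Neg (Neg (neg_trans \<chi>)))"
  proof (rule Neg_Neg_bind)
    fix \<Delta> assume \<Delta>: "set ?\<Gamma> \<subseteq> set \<Delta>" and e: "deriv U \<Delta> (Exists (neg_trans \<phi>))"
    have "deriv U (neg_trans \<phi> # map lift \<Delta>) (lift (neg_trans \<chi>))"
      using \<chi> by (rule deriv_weaken) (use \<Delta> in auto)
    with e show "deriv U \<Delta> (Neg (Neg (neg_trans \<chi>)))" by (intro Neg_Neg_I) (rule deriv.ExistsE)
  qed
  then show ?case by (rule neg_trans_stable)
next
  case (EqRefl \<Gamma> t)
  then show ?case by (simp add: deriv.EqRefl)
next
  case (EqSubst \<Gamma> s t \<phi>)
  then show ?case by (metis deriv.EqSubst neg_trans.simps(2) neg_trans_inst)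
qed simp_all

end

section \<open>The translation on the syntactic classes\<close>

context arithmetic_LEM
begin

text \<open>The added double negations stand on disjunctions and existential formulas of degree at
  most \<open>k\<close>, which are decidable and absorb them.\<close>

lemma F_plus_neg_trans: "\<phi> \<in> F_plus k \<Longrightarrow> eqv U (neg_trans \<phi>) \<phi>"
proof (induction \<phi>)
  case (Disj \<phi> \<psi>)
  then have "\<phi> \<in> F_plus k" "\<psi> \<in> F_plus k" by (auto simp: F_plus_iff)
  then have "eqv U (Disj (neg_trans \<phi>) (neg_trans \<psi>)) (Disj \<phi> \<psi>)"
    using Disj.IH eqv_Disj by blast
  then show ?case
    using decidable_Neg_Neg_eqv[OF F_plus_decidable[OF Disj.prems]] eqv_Imp[OF _ eqv_refl] eqv_trans
    unfolding neg_trans.simps by blast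
next
  case (Exists \<phi>)
  then have "eqv U (Exists (neg_trans \<phi>)) (Exists \<phi>)"
    using F_plus_quant[of Plus] eqv_Exists by simp
  then show ?case
    using decidable_Neg_Neg_eqv[OF F_plus_decidable[OF Exists.prems]] eqv_Imp[OF _ eqv_refl] eqv_trans
    unfolding neg_trans.simps by blast
next
  case (Forall \<phi>)
  then show ?case using F_plus_quant[of Minus] eqv_Forall by simp
qed (auto simp: F_plus_iff ball_Un intro: eqv_Conj eqv_Imp)

text \<open>
  In the two cases of an implication, \<open>J\<close> in negative position is only recovered up to a double
  negation, which the stability of translated formulas absorbs.
\<close>

lemma J_Imp_neg_trans:
  assumes "\<And>\<Gamma>. deriv U \<Gamma> (neg_trans \<phi>) \<Longrightarrow> deriv U \<Gamma> (Neg (Neg \<phi>))"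
    and "\<And>\<Gamma>. deriv U \<Gamma> \<psi> \<Longrightarrow> deriv U \<Gamma> (neg_trans \<psi>)"
    and "deriv U \<Gamma> (Imp \<phi> \<psi>)"
  shows "deriv U \<Gamma> (neg_trans (Imp \<phi> \<psi>))"
  unfolding neg_trans.simps
proof (rule ImpI', rule neg_trans_stable)
  fix \<Delta> assume \<Delta>: "set \<Gamma> \<subseteq> set \<Delta>" and "deriv U \<Delta> (neg_trans \<phi>)"
  then have "deriv U \<Delta> (Neg (Neg \<phi>))" using assms(1) by blast
  then show "deriv U \<Delta> (Neg (Neg (neg_trans \<psi>)))"
  proof (rule Neg_Neg_bind)
    fix E assume "set \<Delta> \<subseteq> set E" "deriv U E \<phi>"
    then have "deriv U E \<psi>" using assms(3) \<Delta> unfolding deriv_Imp_iff by blast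
    then show "deriv U E (Neg (Neg (neg_trans \<psi>)))" using assms(2) Neg_Neg_I by blast
  qed
qed

text \<open>The induction is simultaneous because each class supplies the premises of implications
  in the other. The equation \<open>m = Suc k\<close> leaves the level a variable for the induction
  and excludes level \<open>0\<close>.\<close>

lemma R_J_neg_trans:
  "R_cls m \<phi> \<Longrightarrow> m = Suc k \<Longrightarrow> deriv U \<Gamma> \<phi> \<Longrightarrow> deriv U \<Gamma> (neg_trans \<phi>)"
  "J_cls m \<phi> \<Longrightarrow> m = Suc k \<Longrightarrow> deriv U \<Gamma> (neg_trans \<phi>) \<Longrightarrow> deriv U \<Gamma> (Neg (Neg \<phi>))"
proof (induction arbitrary: \<Gamma> and \<Gamma> rule: R_cls_J_cls.inducts)
  case (R_F \<phi> j)
  then show ?case using F_plus_neg_trans eqv_def by blast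
next
  case (J_F \<phi> j)
  then show ?case using F_plus_neg_trans eqv_def Neg_Neg_I by blast
next
  case (R_Disj j \<phi> \<psi>)
  then show ?case unfolding neg_trans.simps by (blast intro: Neg_Neg_I Disj_mono)
next
  case (R_Forall j \<phi>)
  then show ?case unfolding neg_trans.simps by (blast intro: Forall_mono)
next
  case (R_Imp j \<phi> \<psi>)
  then show ?case using J_Imp_neg_trans by blast
next
  case (J_Conj j \<phi> \<psi>)
  then have \<phi>: "deriv U \<Gamma> (Neg (Neg \<phi>))" and \<psi>: "deriv U \<Gamma> (Neg (Neg \<psi>))" by auto
  from \<phi> show ?case
  proof (rule Neg_Neg_bind)
    fix \<Delta> assume \<Delta>: "set \<Gamma> \<subseteq> set \<Delta>" "deriv U \<Delta> \<phi>"
    from deriv_weaken[OF \<psi> \<Delta>(1)] show "deriv U \<Delta> (Neg (Neg (Conj \<phi> \<psi>)))"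
      by (rule Neg_Neg_bind) (rule Neg_Neg_I, simp add: deriv_weaken[OF \<Delta>(2)])
  qed
next
  case (J_Disj j \<phi> \<psi>)
  have "deriv U \<Gamma> (Neg (Neg (Disj (neg_trans \<phi>) (neg_trans \<psi>))))" using J_Disj.prems by simp
  then show ?case
  proof (rule Neg_Neg_bind)
    fix \<Delta> assume "deriv U \<Delta> (Disj (neg_trans \<phi>) (neg_trans \<psi>))"
    then show "deriv U \<Delta> (Neg (Neg (Disj \<phi> \<psi>)))"
    proof (rule DisjE')
      fix E assume "deriv U E (neg_trans \<phi>)"
      then have "deriv U E (Neg (Neg \<phi>))" using J_Disj by blast
      then show "deriv U E (Neg (Neg (Disj \<phi> \<psi>)))"
        by (rule Neg_Neg_bind) (rule Neg_Neg_I, rule DisjI1)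
    next
      fix E assume "deriv U E (neg_trans \<psi>)"
      then have "deriv U E (Neg (Neg \<psi>))" using J_Disj by blast
      then show "deriv U E (Neg (Neg (Disj \<phi> \<psi>)))"
        by (rule Neg_Neg_bind) (rule Neg_Neg_I, rule DisjI2)
    qed
  qed
next
  case (J_Exists j \<phi>)
  have "deriv U \<Gamma> (Neg (Neg (Exists (neg_trans \<phi>))))" using J_Exists.prems by simp
  then show ?case
  proof (rule Neg_Neg_bind)
    fix \<Delta> assume e: "deriv U \<Delta> (Exists (neg_trans \<phi>))"
    from e e show "deriv U \<Delta> (Neg (Neg (Exists \<phi>)))"
    proof (rule ExistsE')
      fix E assume "deriv U E (neg_trans \<phi>)"
      then have "deriv U E (Neg (Neg \<phi>))" using J_Exists by blast
      then have "deriv U E (Neg (Neg (lift (Exists \<phi>))))"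
        by (rule Neg_Neg_bind) (rule Neg_Neg_I, rule lift_ExistsI)
      then show "deriv U E (lift (Neg (Neg (Exists \<phi>))))" by simp
    qed
  qed
next
  case (J_Imp j \<phi> \<psi>)
  show ?case
  proof (rule Imp_Neg_Neg, rule ImpI')
    fix \<Delta> assume \<Delta>: "set \<Gamma> \<subseteq> set \<Delta>" "deriv U \<Delta> \<phi>"
    then have "deriv U \<Delta> (neg_trans \<phi>)" using J_Imp by blast
    then have "deriv U \<Delta> (neg_trans \<psi>)"
      using J_Imp.prems(2) \<Delta>(1) unfolding neg_trans.simps deriv_Imp_iff[of _ _ "neg_trans \<phi>"] by blast
    then show "deriv U \<Delta> (Neg (Neg \<psi>))" using J_Imp by blast
  qed
qed auto

text \<open>Double negations in front of disjunctions and existential formulas only weaken them. The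
  delicate case is an implication, whose premise lies in \<open>J_cls\<close>.\<close>

lemma Q_neg_trans: "Q_cls m \<phi> \<Longrightarrow> m = Suc k \<Longrightarrow> deriv U \<Gamma> \<phi> \<Longrightarrow> deriv U \<Gamma> (neg_trans \<phi>)"
proof (induction arbitrary: \<Gamma> rule: Q_cls.induct)
  case (Q_Disj j \<phi> \<psi>)
  then show ?case unfolding neg_trans.simps by (blast intro: Neg_Neg_I Disj_mono)
next
  case (Q_Forall j \<phi>)
  then show ?case unfolding neg_trans.simps by (blast intro: Forall_mono)
next
  case (Q_Exists j \<phi>)
  then show ?case unfolding neg_trans.simps by (blast intro: Neg_Neg_I Exists_mono)
next
  case (Q_Imp j \<phi> \<psi>)
  then show ?case using J_Imp_neg_trans R_J_neg_trans(2) by blast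
qed auto

text \<open>One level above \<open>F_plus k\<close> is reached because the translation commutes with
  \<open>Forall\<close>.\<close>

lemma Pi_Suc_neg_trans: "\<phi> \<in> cls Minus (Suc k) \<Longrightarrow> eqv U (neg_trans \<phi>) \<phi>"
proof (induction rule: cls_Suc_induct)
  case (base \<phi>)
  then show ?case using cls_F_plus F_plus_neg_trans by blast
next
  case (quant \<phi>)
  then show ?case by (simp add: eqv_Forall)
qed

lemma PA_Disj_Pi:
  assumes "\<And>\<phi>. \<phi> \<in> X \<Longrightarrow> U \<turnstile> \<phi> \<and> Q_cls (Suc k) \<phi>"
    and "\<phi> \<in> Pi_cls (Suc k)" "\<psi> \<in> Pi_cls (Suc k)" and "PA \<union> X \<turnstile> Disj \<phi> \<psi>"
  shows "U \<turnstile> Neg (Conj (dual \<phi>) (dual \<psi>))"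
proof -
  have "U \<turnstile> neg_trans \<chi>" if "\<chi> \<in> X" for \<chi>
    using assms(1)[OF that] Q_neg_trans unfolding proves_def by blast
  then have "deriv U [] (neg_trans (Disj \<phi> \<psi>))"
    using neg_trans_sound[of X "[]"] assms(4) unfolding proves_def list.map by blast
  moreover have "eqv U (Disj (neg_trans \<phi>) (neg_trans \<psi>)) (Disj \<phi> \<psi>)"
    using assms(2,3) by (intro eqv_Disj Pi_Suc_neg_trans) auto
  then have "eqv U (neg_trans (Disj \<phi> \<psi>)) (Neg (Neg (Disj \<phi> \<psi>)))"
    unfolding neg_trans.simps by (intro eqv_Imp eqv_refl)
  ultimately have n: "deriv U [] (Neg (Neg (Disj \<phi> \<psi>)))" unfolding eqv_def by blast
  show ?thesis unfolding proves_def
  proof (rule ImpI')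
    fix \<Delta> assume "deriv U \<Delta> (Conj (dual \<phi>) (dual \<psi>))"
    then have d: "deriv U \<Delta> (Neg \<phi>)" "deriv U \<Delta> (Neg \<psi>)" by (auto intro: dual_imp_Neg)
    have "deriv U \<Delta> (Neg (Disj \<phi> \<psi>))"
    proof (rule ImpI')
      fix E assume E: "set \<Delta> \<subseteq> set E" and "deriv U E (Disj \<phi> \<psi>)"
      from this(2) show "deriv U E Bot"
        by (rule DisjE') (use d E in \<open>auto simp: deriv_Imp_iff\<close>)
    qed
    then show "deriv U \<Delta> Bot" using deriv_weaken[OF n, of \<Delta>] ImpE by auto
  qed
qed

end

section \<open>The rules\<close>

text \<open>The double negation of the conclusion follows intuitionistically:
  \<open>Neg (Disj \<phi> (Forall \<psi>))\<close> gives \<open>Neg \<phi>\<close>, so the premise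
  yields \<open>Forall \<psi>\<close>. The conclusion is again a disjunction of two
  \<open>Pi\<close> formulas.\<close>

lemma closed_DNE_R_imp_CD_R:
  assumes "closed_DNE_R (disj_cls (Pi_cls (Suc k)) (Pi_cls (Suc k))) U"
  shows "closed_CD_R (Pi_cls (Suc k)) U"
  unfolding closed_CD_R_def
proof (intro ballI impI)
  fix \<phi> \<psi> assume \<phi>: "\<phi> \<in> Pi_cls (Suc k)" and \<psi>: "\<psi> \<in> Pi_cls (Suc k)"
    and f: "U \<turnstile> Forall (Disj (lift \<phi>) \<psi>)"
  have "U \<turnstile> Neg (Neg (Disj \<phi> (Forall \<psi>)))"
    unfolding proves_def
  proof (rule ImpI')
    fix \<Delta> assume n: "deriv U \<Delta> (Neg (Disj \<phi> (Forall \<psi>)))"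
    have n\<phi>: "deriv U \<Delta> (Neg \<phi>)"
    proof (rule ImpI')
      fix E assume "set \<Delta> \<subseteq> set E" "deriv U E \<phi>"
      then show "deriv U E Bot" using n DisjI1 unfolding deriv_Imp_iff by blast
    qed
    have "deriv U \<Delta> (Conj (Forall (Disj (lift \<phi>) \<psi>)) (Neg \<phi>))"
      using n\<phi> proves_deriv[OF f] by simp
    then have "deriv U \<Delta> (Forall \<psi>)"
    proof (rule ForallI')
      fix E assume "deriv U E (lift (Conj (Forall (Disj (lift \<phi>) \<psi>)) (Neg \<phi>)))"
      then have d: "deriv U E (Disj (lift \<phi>) \<psi>)" and n: "deriv U E (Neg (lift \<phi>))"
        by (auto intro: lift_ForallD)
      from d show "deriv U E \<psi>"
        by (rule DisjE') (auto intro: NegE deriv_weaken[OF n])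
    qed
    then show "deriv U \<Delta> Bot" using n DisjI2 ImpE by blast
  qed
  moreover have "Forall \<psi> \<in> Pi_cls (Suc k)" using cls_quant[of \<psi> Minus k] \<psi> by simp
  ultimately show "U \<turnstile> Disj \<phi> (Forall \<psi>)"
    using assms \<phi> unfolding closed_DNE_R_def disj_cls_def by blast
qed

section \<open>From CD-R to DMLD-R\<close>

lemma DMLD_base:
  assumes "U \<turnstile> Neg (Conj \<phi> \<psi>)" and "U \<turnstile> Disj \<phi> (dual \<phi>)" and "U \<turnstile> Disj \<psi> (dual \<psi>)"
  shows "U \<turnstile> Disj (dual \<phi>) (dual \<psi>)"
  unfolding proves_def
proof (rule DisjE'[OF proves_deriv[OF assms(2)]])
  fix \<Delta> assume \<phi>: "deriv U \<Delta> \<phi>"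
  show "deriv U \<Delta> (Disj (dual \<phi>) (dual \<psi>))"
  proof (rule DisjE'[OF proves_deriv[OF assms(3)]])
    fix E assume "set \<Delta> \<subseteq> set E" "deriv U E \<psi>"
    then have "deriv U E (Conj \<phi> \<psi>)" using deriv_weaken[OF \<phi>] by simp
    with proves_deriv[OF assms(1)] show "deriv U E (Disj (dual \<phi>) (dual \<psi>))" by (rule NegE)
  qed (rule DisjI2)
qed (rule DisjI1)

lemma proves_Neg_Conj_commute: "U \<turnstile> Neg (Conj \<phi> \<psi>) \<Longrightarrow> U \<turnstile> Neg (Conj \<psi> \<phi>)"
  using eqv_Imp[OF eqv_Conj_commute eqv_refl] unfolding proves_def eqv_def by blast

lemma proves_Disj_commute: "U \<turnstile> Disj \<phi> \<psi> \<Longrightarrow> U \<turnstile> Disj \<psi> \<phi>"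
  using eqv_Disj_commute unfolding proves_def eqv_def by blast

text \<open>The last assumption is the induction hypothesis for the body, below the binder. Its
  conclusion is generalised to a formula to which CD-R applies, with \<open>dual \<psi>\<close> as
  the disjunct free of the bound variable.\<close>

lemma CD_R_Exists_step:
  assumes "closed_CD_R (Pi_cls (Suc k)) U"
    and "\<phi> \<in> cls Plus (Suc k)" and "\<psi> \<in> cls Plus (Suc k)"
    and "U \<turnstile> Neg (Conj (Exists \<phi>) \<psi>)"
    and "U \<turnstile> Neg (Conj \<phi> (lift \<psi>)) \<Longrightarrow> U \<turnstile> Disj (dual \<phi>) (dual (lift \<psi>))"
  shows "U \<turnstile> Disj (dual (Exists \<phi>)) (dual \<psi>)"
proof -
  have n: "U \<turnstile> Neg (Conj (lift (Exists \<phi>)) (lift \<psi>))"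
    using proves_subst[OF assms(4)] unfolding lift_def by simp
  have "U \<turnstile> Neg (Conj \<phi> (lift \<psi>))"
    unfolding proves_def
  proof (rule ImpI')
    fix \<Delta> assume "deriv U \<Delta> (Conj \<phi> (lift \<psi>))"
    then have "deriv U \<Delta> (Conj (lift (Exists \<phi>)) (lift \<psi>))" using lift_ExistsI by simp
    with proves_deriv[OF n] show "deriv U \<Delta> Bot" by (rule ImpE)
  qed
  then have "U \<turnstile> Disj (lift (dual \<psi>)) (dual \<phi>)"
    using assms(5) proves_Disj_commute dual_lift by simp
  then have "U \<turnstile> Forall (Disj (lift (dual \<psi>)) (dual \<phi>))"
    unfolding proves_def by (intro ForallI) simp
  moreover have "dual \<phi> \<in> Pi_cls (Suc k)" "dual \<psi> \<in> Pi_cls (Suc k)"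
    using cls_dual[OF assms(2)] cls_dual[OF assms(3)] by simp_all
  ultimately have "U \<turnstile> Disj (dual \<psi>) (Forall (dual \<phi>))"
    using assms(1) unfolding closed_CD_R_def by blast
  then show ?thesis using proves_Disj_commute by simp
qed

context arithmetic
begin

lemma CD_R_Pi_dual:
  assumes "closed_CD_R (Pi_cls (Suc k)) U" and "j \<le> k" and "\<phi> \<in> cls Minus j"
  shows "U \<turnstile> Disj \<phi> (dual \<phi>)"
  using assms(2,3)
proof (induction j arbitrary: \<phi>)
  case 0
  then show ?case using qfree_decidable by (simp add: dual_qfree decidable_def)
next
  case (Suc j)
  have "decidable U \<psi>" if \<psi>: "\<psi> \<in> Sigma_cls j" for \<psi>
  proof -
    have dual: "dual \<psi> \<in> cls Minus j" using cls_dual[of \<psi> Plus j] \<psi> by simp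
    have "deriv U [] (Disj (dual \<psi>) (dual (dual \<psi>)))"
      using Suc.IH[OF _ dual] Suc.prems(1) unfolding proves_def by simp
    then have "deriv U [] (Disj (dual \<psi>) \<psi>)"
      using eqv_Disj[OF eqv_refl dual_dual_eqv[of \<psi> Plus j]] \<psi> unfolding eqv_def by simp
    then have "U \<turnstile> Disj \<psi> (dual \<psi>)" using eqv_Disj_commute unfolding proves_def eqv_def by blast
    then show ?thesis by (rule decidable_of_dual)
  qed
  note Sigma = this
  from Suc.prems(2) show ?case
  proof (induction rule: cls_Suc_induct)
    case (base \<phi>)
    then have "decidable U \<phi> \<and> eqv U (dual \<phi>) (Neg \<phi>)" using Sigma cls_decidable_dual by blast
    then show ?case using decidable_dual by blast
  next
    case (quant \<phi>)
    have "dual (quant Minus \<phi>) \<in> cls Plus (Suc j)"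
      using cls_dual[OF cls_quant[OF quant.hyps]] by simp
    then have "dual (quant Minus \<phi>) \<in> cls Minus (Suc (Suc j))" by (rule cls_Suc_any)
    then have e: "Exists (dual \<phi>) \<in> Pi_cls (Suc k)"
      using cls_mono[of "Suc (Suc j)" "Suc k" _ Minus] Suc.prems(1) by simp
    have p: "\<phi> \<in> Pi_cls (Suc k)"
      using cls_mono[of "Suc j" "Suc k" _ Minus] Suc.prems(1) quant.hyps by simp
    have "deriv U [] (Disj (dual \<phi>) \<phi>)"
      using quant.IH eqv_Disj_commute unfolding proves_def eqv_def by blast
    then have "deriv U [] (Disj (lift (Exists (dual \<phi>))) \<phi>)"
      by (rule Disj_mono) (auto intro: lift_ExistsI)
    then have "U \<turnstile> Forall (Disj (lift (Exists (dual \<phi>))) \<phi>)"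
      unfolding proves_def by (intro ForallI) simp
    then have "U \<turnstile> Disj (Exists (dual \<phi>)) (Forall \<phi>)"
      using assms(1) e p unfolding closed_CD_R_def by blast
    then have "U \<turnstile> Disj (Forall \<phi>) (Exists (dual \<phi>))"
      using eqv_Disj_commute unfolding proves_def eqv_def by blast
    then show ?case by simp
  qed
qed

lemma closed_CD_R_imp_DMLD_R:
  assumes CD: "closed_CD_R (Pi_cls (Suc k)) U"
  shows "closed_DMLD_R (Sigma_cls (Suc k)) U"
proof -
  have Pi: "U \<turnstile> Disj (dual \<phi>) (dual \<psi>)"
    if "\<psi> \<in> cls Plus (Suc k)" "\<phi> \<in> cls Minus k" "U \<turnstile> Neg (Conj \<phi> \<psi>)" for \<phi> \<psi>
    using that
  proof (induction arbitrary: \<phi> rule: cls_Suc_induct)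
    case (base \<psi>)
    then show ?case using DMLD_base CD_R_Pi_dual[OF CD order_refl] by simp
  next
    case (quant \<psi>)
    have \<phi>: "\<phi> \<in> cls Plus (Suc k)" using quant.prems(1) by (rule cls_Suc_any)
    have "U \<turnstile> Neg (Conj (Exists \<psi>) \<phi>)" using quant.prems(2) proves_Neg_Conj_commute by simp
    with CD quant.hyps \<phi> have "U \<turnstile> Disj (dual (Exists \<psi>)) (dual \<phi>)"
    proof (rule CD_R_Exists_step)
      assume "U \<turnstile> Neg (Conj \<psi> (lift \<phi>))"
      then show "U \<turnstile> Disj (dual \<psi>) (dual (lift \<phi>))"
        using quant.IH[OF cls_lift[OF quant.prems(1)]] proves_Neg_Conj_commute proves_Disj_commute
        by blast
    qed
    then show ?case using proves_Disj_commute by simp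
  qed
  have "U \<turnstile> Disj (dual \<phi>) (dual \<psi>)"
    if "\<phi> \<in> cls Plus (Suc k)" "\<psi> \<in> cls Plus (Suc k)" "U \<turnstile> Neg (Conj \<phi> \<psi>)" for \<phi> \<psi>
    using that
  proof (induction arbitrary: \<psi> rule: cls_Suc_induct)
    case (base \<phi>)
    then show ?case using Pi by simp
  next
    case (quant \<phi>)
    then show ?case using CD_R_Exists_step[OF CD] cls_lift unfolding quant.simps by blast
  qed
  then show ?thesis unfolding closed_DMLD_R_def by simp
qed

lemma DMLD_R_Sigma_decidable:
  assumes "closed_DMLD_R (Sigma_cls (Suc k)) U" and "\<phi> \<in> Sigma_cls k"
  shows "decidable U \<phi>"
proof -
  have \<phi>: "\<phi> \<in> cls Plus k" using assms(2) by simp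
  have "\<phi> \<in> Sigma_cls (Suc k)" using cls_Suc_any[OF \<phi>, of Plus] by simp
  moreover have "dual \<phi> \<in> Sigma_cls (Suc k)" using cls_Suc_any[OF cls_dual[OF \<phi>], of Plus] by simp
  ultimately have "U \<turnstile> Disj (dual \<phi>) (dual (dual \<phi>))"
    using assms(1) Neg_Conj_dual unfolding closed_DMLD_R_def by blast
  then have "U \<turnstile> Disj (dual \<phi>) \<phi>"
    using eqv_Disj[OF eqv_refl dual_dual_eqv[OF \<phi>]] unfolding proves_def eqv_def by blast
  then show ?thesis using proves_Disj_commute decidable_of_dual by blast
qed

lemma closed_DMLD_R_imp_DML_R:
  assumes "closed_DMLD_R (Sigma_cls (Suc k)) U"
  shows "closed_DML_R (Sigma_cls (Suc k)) U \<and> (\<forall>\<phi>\<in>DNE (Sigma_cls k). U \<turnstile> \<phi>)"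
proof
  show "closed_DML_R (Sigma_cls (Suc k)) U"
    using assms unfolding closed_DML_R_def closed_DMLD_R_def proves_def
    by (blast intro: Disj_mono dual_imp_Neg)
  show "\<forall>\<phi>\<in>DNE (Sigma_cls k). U \<turnstile> \<phi>"
    using DMLD_R_Sigma_decidable[OF assms] decidable_stable
    unfolding DNE_def proves_def by (blast intro: ImpI')
qed

lemma DML_R_Sigma_decidable:
  assumes DML: "closed_DML_R (Sigma_cls (Suc k)) U" and DNE: "\<forall>\<phi>\<in>DNE (Sigma_cls k). U \<turnstile> \<phi>"
    and "j \<le> k" and "\<phi> \<in> Sigma_cls j"
  shows "decidable U \<phi>"
  using assms(3,4)
proof (induction j arbitrary: \<phi>)
  case 0
  then show ?case using qfree_decidable by simp
next
  case (Suc j)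
  have \<phi>: "\<phi> \<in> cls Plus k" using cls_mono[of "Suc j" k \<phi> Plus] Suc.prems by simp
  have "\<phi> \<in> Sigma_cls (Suc k)" using cls_Suc_any[OF \<phi>, of Plus] by simp
  moreover have "dual \<phi> \<in> Sigma_cls (Suc k)" using cls_Suc_any[OF cls_dual[OF \<phi>], of Plus] by simp
  ultimately have d: "U \<turnstile> Disj (Neg \<phi>) (Neg (dual \<phi>))"
    using DML Neg_Conj_dual unfolding closed_DML_R_def by blast
  have "eqv U (dual \<phi>) (Neg \<phi>)"
    using Suc by (intro Sigma_Suc_dual_eqv_Neg[of j]) auto
  then have e: "eqv U (Neg (dual \<phi>)) (Neg (Neg \<phi>))" by (rule eqv_Imp) simp
  have "U \<turnstile> Imp (Neg (Neg \<phi>)) \<phi>" using DNE \<phi> unfolding DNE_def by auto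
  then have "deriv U \<Delta> \<phi>" if "deriv U \<Delta> (Neg (dual \<phi>))" for \<Delta>
    using that e proves_deriv ImpE unfolding eqv_def by blast
  then have "U \<turnstile> Disj (Neg \<phi>) \<phi>"
    using d unfolding proves_def by (blast intro: Disj_mono)
  then show ?case unfolding decidable_def by (rule proves_Disj_commute)
qed

lemma closed_DML_R_imp_DMLD_R:
  assumes "closed_DML_R (Sigma_cls (Suc k)) U" and "\<forall>\<phi>\<in>DNE (Sigma_cls k). U \<turnstile> \<phi>"
  shows "closed_DMLD_R (Sigma_cls (Suc k)) U"
  unfolding closed_DMLD_R_def
proof (intro ballI impI)
  fix \<phi> \<psi> assume c: "\<phi> \<in> Sigma_cls (Suc k)" "\<psi> \<in> Sigma_cls (Suc k)" and n: "U \<turnstile> Neg (Conj \<phi> \<psi>)"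
  have "eqv U (Disj (dual \<phi>) (dual \<psi>)) (Disj (Neg \<phi>) (Neg \<psi>))"
    using c DML_R_Sigma_decidable[OF assms order_refl] Sigma_Suc_dual_eqv_Neg
    by (intro eqv_Disj) blast+
  then show "U \<turnstile> Disj (dual \<phi>) (dual \<psi>)"
    using assms(1) c n unfolding closed_DML_R_def proves_def eqv_def by blast
qed

lemma closed_DMLD_R_imp_conservative:
  assumes DMLD: "closed_DMLD_R (Sigma_cls (Suc k)) U"
    and X: "\<And>\<phi>. \<phi> \<in> X \<Longrightarrow> U \<turnstile> \<phi> \<and> Q_cls (Suc k) \<phi>"
  shows "conservative (disj_cls (Pi_cls (Suc k)) (Pi_cls (Suc k))) (PA \<union> X) U"
  unfolding conservative_def disj_cls_def
proof clarify
  fix \<phi> \<psi> assume c: "\<phi> \<in> Pi_cls (Suc k)" "\<psi> \<in> Pi_cls (Suc k)" and p: "PA \<union> X \<turnstile> Disj \<phi> \<psi>"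
  interpret arithmetic_LEM U k
    by unfold_locales (rule DMLD_R_Sigma_decidable[OF DMLD])
  have m: "\<phi> \<in> cls Minus (Suc k)" "\<psi> \<in> cls Minus (Suc k)" using c by simp_all
  have "dual \<phi> \<in> Sigma_cls (Suc k)" "dual \<psi> \<in> Sigma_cls (Suc k)"
    using cls_dual[OF m(1)] cls_dual[OF m(2)] by simp_all
  moreover have "U \<turnstile> Neg (Conj (dual \<phi>) (dual \<psi>))" using X c p by (rule PA_Disj_Pi)
  ultimately have "U \<turnstile> Disj (dual (dual \<phi>)) (dual (dual \<psi>))"
    using DMLD unfolding closed_DMLD_R_def by blast
  then show "U \<turnstile> Disj \<phi> \<psi>"
    using eqv_Disj[OF dual_dual_eqv[OF m(1)] dual_dual_eqv[OF m(2)]]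
    unfolding proves_def eqv_def by blast
qed

end

lemma PA_stable: "PA \<union> X \<turnstile> Neg (Neg \<phi>) \<Longrightarrow> PA \<union> X \<turnstile> \<phi>"
proof -
  have "decidable (PA \<union> X) \<phi>"
    unfolding decidable_def proves_def PA_def by (rule Ax) blast
  then show "PA \<union> X \<turnstile> Neg (Neg \<phi>) \<Longrightarrow> PA \<union> X \<turnstile> \<phi>"
    using decidable_stable unfolding proves_def by blast
qed

theorem theorem5p19:
  fixes k :: nat and T X :: "fm set"
  assumes "semi_classical T"
    and "\<forall>\<phi>\<in>X. sentence \<phi> \<and> Q_cls (Suc k) \<phi>"
  shows
    "(conservative (disj_cls (Pi_cls (Suc k)) (Pi_cls (Suc k))) (PA \<union> X) (T \<union> X)
        \<longleftrightarrow> closed_DNE_R (disj_cls (Pi_cls (Suc k)) (Pi_cls (Suc k))) (T \<union> X))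
     \<and> (closed_DNE_R (disj_cls (Pi_cls (Suc k)) (Pi_cls (Suc k))) (T \<union> X)
        \<longleftrightarrow> closed_CD_R (Pi_cls (Suc k)) (T \<union> X))
     \<and> (closed_CD_R (Pi_cls (Suc k)) (T \<union> X)
        \<longleftrightarrow> closed_DMLD_R (Sigma_cls (Suc k)) (T \<union> X))
     \<and> (closed_DMLD_R (Sigma_cls (Suc k)) (T \<union> X)
        \<longleftrightarrow> closed_DML_R (Sigma_cls (Suc k)) (T \<union> X) \<and>
             (\<forall>\<phi> \<in> DNE (Sigma_cls k). T \<union> X \<turnstile> \<phi>))"
  (is "(?one \<longleftrightarrow> ?two) \<and> (_ \<longleftrightarrow> ?three) \<and> (_ \<longleftrightarrow> ?four) \<and> (_ \<longleftrightarrow> ?five)")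
proof -
  have HA: "T \<turnstile> \<phi>" if "HA \<turnstile> \<phi>" for \<phi>
    using assms(1) that unfolding semi_classical_def by blast
  interpret arithmetic "T \<union> X"
  proof
    fix \<phi> assume "\<phi> \<in> HA"
    then have "HA \<turnstile> \<phi>" unfolding proves_def by (rule Ax)
    then show "T \<union> X \<turnstile> \<phi>" using HA proves_mono by blast
  qed
  have PA: "PA \<union> X \<turnstile> \<phi>" if "T \<union> X \<turnstile> \<phi>" for \<phi>
    using that
  proof (rule proves_cut)
    fix \<psi> assume "\<psi> \<in> T \<union> X"
    then consider "T \<turnstile> \<psi>" | "\<psi> \<in> X" unfolding proves_def by (blast intro: Ax)
    then show "PA \<union> X \<turnstile> \<psi>"
    proof cases
      case 1
      then have "PA \<turnstile> \<psi>" using assms(1) unfolding semi_classical_def by blast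
      then show ?thesis by (rule proves_mono) blast
    next
      case 2
      then show ?thesis unfolding proves_def by (blast intro: Ax)
    qed
  qed
  have "?one \<Longrightarrow> ?two"
    unfolding conservative_def closed_DNE_R_def using PA PA_stable by blast
  moreover have "?two \<Longrightarrow> ?three" by (rule closed_DNE_R_imp_CD_R)
  moreover have "?three \<Longrightarrow> ?four" by (rule closed_CD_R_imp_DMLD_R)
  moreover have "?four \<Longrightarrow> ?five" by (rule closed_DMLD_R_imp_DML_R)
  moreover have "?five \<Longrightarrow> ?four" using closed_DML_R_imp_DMLD_R by blast
  moreover have "?four \<Longrightarrow> ?one"
  proof (erule closed_DMLD_R_imp_conservative)
    fix \<phi> assume "\<phi> \<in> X"
    then show "T \<union> X \<turnstile> \<phi> \<and> Q_cls (Suc k) \<phi>"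
      using assms(2) unfolding proves_def by (blast intro: Ax)
  qed
  ultimately show ?thesis by blast
qed

end
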